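(* Let $H\in C(\mathbb T^d\times\mathbb R^d)$ be such that $p\mapsto H(x,p)$ is convex for every $x\in\mathbb T^d$, and let $c\in\mathbb R$. For $\lambda\ge 0$ consider the nonlocal Hamilton-Jacobi equation $$\lambda u-\mathcal I u+H(x,Du)=c\quad\text{in }\mathbb T^d. \qquad (E_\lambda)$$ Assume that for every $\lambda\in[0,1)$ equation $(E_\lambda)$ admits continuous solutions, and that there is a constant $\kappa>0$, independent of $\lambda$, such that for every $\lambda\in[0,1)$ all continuous solutions of $(E_\lambda)$ are $\kappa$-Lipschitz. Then, for each $\lambda\in(0,1)$, equation $(E_\lambda)$ admits a unique continuous solution $u_\lambda$, and the family $\{u_\lambda:\lambda\in(0,1)\}$ converges uniformly on $\mathbb T^d$, as $\lambda\to0^+$, to a solution $u_0$ of $(E_0)$.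
   Context: $\mathbb T^d=\mathbb R^d/\mathbb Z^d$; functions on $\mathbb T^d$ are identified with $\mathbb Z^d$-periodic functions on $\mathbb R^d$. $B_R$ is the open ball of radius $R$ centered at $0$ in $\mathbb R^d$, $B=B_1$, $\mathbf 1_B$ its characteristic function. Standing assumptions: $\nu$ is a positive Borel measure on $\mathbb R^d$ and $j:\mathbb T^d\times\mathbb R^d\to\mathbb R^d$ is Borel measurable, with: (N) $\int_{\mathbb R^d}1\wedge|z|^2\,\nu(dz)\le C_\nu$ for some $C_\nu>0$; (J1) there is $C_j>0$ with $|j(x,z)|\le C_j|z|$ and $|j(x,z)-j(y,z)|\le C_j|x-y||z|$ for all $x,y\in\mathbb T^d$, $z\in\mathbb R^d$; (J2) for every $R>0$ there is $C_R>0$ with $\int_{\mathbb R^d\setminus B_R}|j(x,z)-j(y,z)|\,\nu(dz)\le C_R|x-y|$ for all $x,y\in\mathbb T^d$. For $\varphi\in C^2(\mathbb T^d)$, $$\mathcal I\varphi(x)=\int_{\mathbb R^d}\big(\varphi(x+j(x,z))-\varphi(x)-\mathbf 1_B(z)\langle j(x,z),D\varphi(x)\rangle\big)\nu(dz).$$ Solutions are in the viscosity sense: $u\in C(\mathbb T^d)$ is a subsolution (resp. supersolution) of $\lambda u-\mathcal Iu+H(x,Du)=c$ in $\mathbb T^d$ if, whenever $\varphi\in C^2(\mathbb T^d)$ and $u-\varphi$ attains its maximum (resp. minimum) over $\mathbb T^d$ at $\hat x$, one has $\lambda u(\hat x)-\mathcal I\varphi(\hat x)+H(\hat x,D\varphi(\hat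 x))\le c$ (resp. $\ge c$). A solution is both a sub- and a supersolution. *)

theory Defs
  imports "HOL-Analysis.Analysis"
begin

text \<open>
  Functions on the torus are represented by their lifts, i.e. by functions on \<open>real ^ 'n\<close>
  that are invariant under translation by integer vectors. For such functions, continuity,
  Lipschitz bounds, extrema and uniform convergence on the torus are the corresponding
  notions for the lift. In particular, a Lipschitz bound with respect to the quotient
  distance is the same as one with respect to the Euclidean distance of arbitrary
  representatives: the quotient distance is attained by a pair of representatives and
  the left-hand side does not depend on their choice.
\<close>

definition periodic :: "(real ^ 'n::finite \<Rightarrow> 'b) \<Rightarrow> bool" where
  "periodic f \<longleftrightarrow> (\<forall>x k. (\<forall>i. k $ i \<in> \<int>) \<longrightarrow> f (x + k) = f x)"

definition C0_torus :: "(real ^ 'n::finite \<Rightarrow> real) set" where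
  "C0_torus = {u. periodic u \<and> continuous_on UNIV u}"

definition C2_torus :: "(real ^ 'n::finite \<Rightarrow> real) set" where
  "C2_torus = {\<phi>. periodic \<phi> \<and>
     (\<exists>D D2. (\<forall>x. GDERIV \<phi> x :> D x) \<and>
             (\<forall>x. (D has_derivative (\<lambda>h. D2 x *v h)) (at x)) \<and>
             continuous_on UNIV (D2 :: real ^ 'n \<Rightarrow> real ^ 'n ^ 'n))}"

definition grad :: "('a::real_inner \<Rightarrow> real) \<Rightarrow> 'a \<Rightarrow> 'a" where
  "grad \<phi> x = (THE D. GDERIV \<phi> x :> D)"

lemma grad_eqI:
  assumes "GDERIV \<phi> x :> D"
  shows "grad \<phi> x = D"
  unfolding grad_def
proof (rule the_equality)
  fix D' assume "GDERIV \<phi> x :> D'"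
  then have "(\<lambda>h. inner h D') = (\<lambda>h. inner h D)"
    using assms unfolding gderiv_def by (rule has_derivative_unique)
  then show "D' = D"
    by (simp only: fun_eq_iff vector_eq_ldot)
qed (fact assms)

definition nonlocal_op ::
  "(real ^ 'n) measure \<Rightarrow> (real ^ 'n \<Rightarrow> real ^ 'n \<Rightarrow> real ^ 'n) \<Rightarrow>
   (real ^ 'n \<Rightarrow> real) \<Rightarrow> real ^ 'n::finite \<Rightarrow> real" where
  "nonlocal_op \<nu> j \<phi> x =
     (\<integral>z. (\<phi> (x + j x z) - \<phi> x - indicator (ball 0 1) z * (j x z \<bullet> grad \<phi> x)) \<partial>\<nu>)"

definition viscosity_subsolution ::
  "(real ^ 'n) measure \<Rightarrow> (real ^ 'n \<Rightarrow> real ^ 'n \<Rightarrow> real ^ 'n) \<Rightarrow>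
   (real ^ 'n \<Rightarrow> real ^ 'n \<Rightarrow> real) \<Rightarrow> real \<Rightarrow> real \<Rightarrow> (real ^ 'n::finite \<Rightarrow> real) \<Rightarrow> bool" where
  "viscosity_subsolution \<nu> j H c l u \<longleftrightarrow> u \<in> C0_torus \<and>
     (\<forall>\<phi>\<in>C2_torus. \<forall>x. (\<forall>y. u y - \<phi> y \<le> u x - \<phi> x) \<longrightarrow>
        l * u x - nonlocal_op \<nu> j \<phi> x + H x (grad \<phi> x) \<le> c)"

definition viscosity_supersolution ::
  "(real ^ 'n) measure \<Rightarrow> (real ^ 'n \<Rightarrow> real ^ 'n \<Rightarrow> real ^ 'n) \<Rightarrow>
   (real ^ 'n \<Rightarrow> real ^ 'n \<Rightarrow> real) \<Rightarrow> real \<Rightarrow> real \<Rightarrow> (real ^ 'n::finite \<Rightarrow> real) \<Rightarrow> bool" where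
  "viscosity_supersolution \<nu> j H c l u \<longleftrightarrow> u \<in> C0_torus \<and>
     (\<forall>\<phi>\<in>C2_torus. \<forall>x. (\<forall>y. u x - \<phi> x \<le> u y - \<phi> y) \<longrightarrow>
        l * u x - nonlocal_op \<nu> j \<phi> x + H x (grad \<phi> x) \<ge> c)"

definition viscosity_solution ::
  "(real ^ 'n) measure \<Rightarrow> (real ^ 'n \<Rightarrow> real ^ 'n \<Rightarrow> real ^ 'n) \<Rightarrow>
   (real ^ 'n \<Rightarrow> real ^ 'n \<Rightarrow> real) \<Rightarrow> real \<Rightarrow> real \<Rightarrow> (real ^ 'n::finite \<Rightarrow> real) \<Rightarrow> bool" where
  "viscosity_solution \<nu> j H c l u \<longleftrightarrow>
     viscosity_subsolution \<nu> j H c l u \<and> viscosity_supersolution \<nu> j H c l u"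

end

theory Submission
  imports Defs "HOL-Complex_Analysis.Great_Picard"
begin

text \<open>
  The selection argument needs no Mather measures. Write the equation as
  \<open>l u + F[u] = c\<close> with \<open>F\<close> convex. If \<open>v\<close> solves the equation with discount \<open>0\<close>
  and \<open>u\<^sub>m\<close> the one with discount \<open>m\<close>, then for \<open>0 < l < m\<close> and \<open>\<theta> = l / m\<close> the combination
  \<open>(1 - \<theta>) v + \<theta> u\<^sub>m\<close> satisfies
  \<open>l w + F[w] \<le> c + (1 - \<theta>) l (v - u\<^sub>m)\<close>, so comparison gives
  \<open>u\<^sub>l \<ge> (1 - \<theta>) v + \<theta> u\<^sub>m - \<parallel>v - u\<^sub>m\<parallel>\<close>. Letting first \<open>l\<close> and then \<open>m\<close> tend to \<open>0\<close> along
  subsequences shows that every limit point of \<open>u\<^sub>l\<close> dominates every other one; hence the limit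
  is unique, and Arzela-Ascoli gives convergence. Comparison for a convex combination of two subsolutions against a
  supersolution is proved by tripling the variables with a periodic penalty: the Lipschitz
  bounds keep the gradients of the penalty bounded, small jumps are controlled by the second
  derivatives of the penalty, and the remaining jumps by the maximality of the penalized functional.
\<close>

section \<open>Periodic functions\<close>

text \<open>A test function touching \<open>(1 - \<theta>) v + \<theta> u\<close> from above need
  not touch either summand, even after shifts, so a convex combination of viscosity subsolutions
  cannot be tested directly; hence one variable per function. Weighting the penalty terms by the
  same coefficients \<open>a\<close>, \<open>b\<close> makes the gradients \<open>q1\<close>,
  \<open>q2\<close> seen by the subsolutions combine to \<open>a q1 + b q2\<close> at the
  supersolution, and there convexity of \<open>H\<close> applies. A second obstacle: the definition
  evaluates the nonlocal operator on the test function along all jumps, whereas comparison needs the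
  functions themselves away from small jumps. Test functions squeezed between \<open>u\<close> and
  \<open>\<phi>\<close> bridge this. The order of limits matters. The truncation radius
  \<open>\<delta>\<close> goes to 0 at fixed \<open>\<epsilon>\<close>, which removes the error of
  size \<open>1 / \<epsilon>\<close> from small jumps. Only then does \<open>\<epsilon>\<close> go
  to 0: the maximizing points are at distance \<open>r\<close> = O(\<open>\<epsilon>\<close>), so
  the middle jumps cost \<open>r^2 / \<epsilon>\<close>, which vanishes.\<close>

definition unit_cell :: "(real ^ 'n::finite) set" where
  "unit_cell = {h. \<forall>i. \<bar>h $ i\<bar> \<le> 1 / 2}"

lemma compact_unit_cell: "compact (unit_cell :: (real ^ 'n::finite) set)"
proof -
  have *: "\<bar>t\<bar> \<le> 1 / 2 \<longleftrightarrow> - (1 / 2) \<le> t \<and> t \<le> 1 / 2" for t :: real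
    by arith
  have "(unit_cell :: (real ^ 'n) set) = cbox (\<chi> i. - (1 / 2)) (\<chi> i. (1 / 2 :: real))"
    unfolding unit_cell_def set_eq_iff mem_box_cart mem_Collect_eq vec_lambda_beta * by blast
  then show ?thesis using compact_cbox by metis
qed

lemma periodicD: "periodic f \<Longrightarrow> (\<And>i. k $ i \<in> \<int>) \<Longrightarrow> f (x + k) = f x"
  unfolding periodic_def by blast

text \<open>Coordinatewise rounding. The closed cell meets its translates along faces, which is
  harmless: only existence of a representative is used, and closedness gives compactness.\<close>

lemma shift_into_unit_cell:
  fixes x :: "real ^ 'n::finite"
  obtains k where "\<And>i. k $ i \<in> \<int>" "x + k \<in> unit_cell"
proof
  show "(\<chi> i. - of_int (round (x $ i)) :: real ^ 'n) $ i \<in> \<int>" for i by simp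
  show "x + (\<chi> i. - of_int (round (x $ i))) \<in> unit_cell"
    using of_int_round_abs_le[of "x $ i" for i] unfolding unit_cell_def
    by (simp add: abs_minus_commute)
qed

lemma periodic_bounded:
  fixes f :: "real ^ 'n::finite \<Rightarrow> 'b::real_normed_vector"
  assumes "periodic f" "continuous_on UNIV f"
  obtains B where "B > 0" "\<And>x. norm (f x) \<le> B"
proof -
  have "bounded (f ` unit_cell)"
    using assms(2) compact_unit_cell
    by (meson compact_continuous_image compact_imp_bounded continuous_on_subset subset_UNIV)
  then obtain B where B: "B > 0" "\<And>x. x \<in> unit_cell \<Longrightarrow> norm (f x) \<le> B"
    unfolding bounded_pos by auto
  have "norm (f x) \<le> B" for x
    using B(2) periodicD[OF assms(1)] by (metis shift_into_unit_cell)
  with B(1) show thesis by (rule that)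
qed

lemma C0_torus_attains_max:
  assumes "u \<in> C0_torus"
  obtains x where "x \<in> unit_cell" "\<And>y. u y \<le> u x"
proof -
  have per: "periodic u" and cont: "continuous_on unit_cell u"
    using assms unfolding C0_torus_def by (auto intro: continuous_on_subset)
  have "unit_cell \<noteq> {}" by (metis empty_iff shift_into_unit_cell)
  then obtain x where x: "x \<in> unit_cell" "\<forall>y\<in>unit_cell. u y \<le> u x"
    using continuous_attains_sup[OF compact_unit_cell _ cont] by blast
  have "u y \<le> u x" for y
    using x(2) periodicD[OF per] by (metis shift_into_unit_cell)
  with x(1) show thesis by (rule that)
qed

section \<open>Calculus of C^2 functions on the torus\<close>

lemma GDERIV_periodic:
  assumes "periodic \<phi>" "\<And>x. GDERIV \<phi> x :> D x"
  shows "periodic D"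
  unfolding periodic_def
proof (intro allI impI)
  fix x k :: "real ^ 'a" assume k: "\<forall>i. k $ i \<in> \<int>"
  have "((\<lambda>y. \<phi> (y + k)) has_derivative (\<lambda>h. h \<bullet> D (x + k))) (at x)"
    using assms(2)[of "x + k"] unfolding gderiv_def
    by (intro has_derivative_compose[where f = "\<lambda>y. y + k" and f' = "\<lambda>h. h" and g = \<phi>]
        has_derivative_add_const has_derivative_ident)
  moreover have "(\<lambda>y. \<phi> (y + k)) = \<phi>" using periodicD[OF assms(1)] k by auto
  ultimately have "GDERIV \<phi> x :> D (x + k)" by (simp add: gderiv_def)
  then show "D (x + k) = D x" using assms(2) grad_eqI by metis
qed

lemma jacobian_periodic:
  fixes D :: "real ^ 'n::finite \<Rightarrow> real ^ 'n"
  assumes "periodic D" "\<And>x. (D has_derivative (\<lambda>h. D2 x *v h)) (at x)"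
  shows "periodic D2"
  unfolding periodic_def
proof (intro allI impI)
  fix x k :: "real ^ 'n" assume k: "\<forall>i. k $ i \<in> \<int>"
  have "((\<lambda>y. D (y + k)) has_derivative (\<lambda>h. D2 (x + k) *v h)) (at x)"
    using assms(2)[of "x + k"]
    by (intro has_derivative_compose[where f = "\<lambda>y. y + k" and f' = "\<lambda>h. h" and g = D]
        has_derivative_add_const has_derivative_ident)
  moreover have "(\<lambda>y. D (y + k)) = D" using periodicD[OF assms(1)] k by auto
  ultimately have "(\<lambda>h. D2 (x + k) *v h) = (\<lambda>h. D2 x *v h)"
    using assms(2) has_derivative_unique by metis
  then show "D2 (x + k) = D2 x" by (simp add: matrix_eq fun_eq_iff)
qed

lemma matrix_vector_norm_le:
  fixes A :: "real ^ 'n::finite ^ 'm::finite"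
  shows "norm (A *v h) \<le> real CARD('m) * norm A * norm h"
proof -
  have "norm (A *v h) \<le> (\<Sum>i\<in>UNIV. \<bar>(A *v h) $ i\<bar>)" by (rule norm_le_l1_cart)
  also have "\<dots> \<le> (\<Sum>i\<in>(UNIV::'m set). norm A * norm h)"
  proof (rule sum_mono)
    fix i
    have "\<bar>(A *v h) $ i\<bar> \<le> norm (A $ i) * norm h"
      using Cauchy_Schwarz_ineq2[of "A $ i" h]
      by (simp add: matrix_vector_mul_component)
    also have "\<dots> \<le> norm A * norm h"
      by (intro mult_right_mono Finite_Cartesian_Product.norm_nth_le) auto
    finally show "\<bar>(A *v h) $ i\<bar> \<le> norm A * norm h" .
  qed
  finally show ?thesis by simp
qed

lemma C2_torusI:
  fixes \<phi> :: "real ^ 'n::finite \<Rightarrow> real"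
  assumes "periodic \<phi>" "\<And>x. GDERIV \<phi> x :> D x"
    "\<And>x. (D has_derivative (\<lambda>h. J x *v h)) (at x)"
    "continuous_on UNIV (J :: real ^ 'n \<Rightarrow> real ^ 'n ^ 'n)"
  shows "\<phi> \<in> C2_torus"
  using assms unfolding C2_torus_def by blast

lemma C2_torusE:
  assumes "\<phi> \<in> C2_torus"
  obtains D2 :: "real ^ 'n::finite \<Rightarrow> real ^ 'n ^ 'n" where "periodic \<phi>"
    "\<And>x. (grad \<phi> has_derivative (\<lambda>h. D2 x *v h)) (at x)" "continuous_on UNIV D2"
proof -
  obtain D D2 where per: "periodic \<phi>" and D: "\<And>x. GDERIV \<phi> x :> D x"
    and D2: "\<And>x. (D has_derivative (\<lambda>h. D2 x *v h)) (at x)"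
    and D2c: "continuous_on UNIV (D2 :: real ^ 'n \<Rightarrow> real ^ 'n ^ 'n)"
    using assms unfolding C2_torus_def by blast
  have "grad \<phi> = D" using D grad_eqI by blast
  with per D2 D2c show thesis by (intro that) auto
qed

lemma C2_torus_GDERIV:
  assumes "\<phi> \<in> C2_torus"
  shows "GDERIV \<phi> x :> grad \<phi> x"
  using assms grad_eqI unfolding C2_torus_def by (smt (verit, best) mem_Collect_eq)

lemma C2_torus_continuous:
  assumes "\<phi> \<in> C2_torus"
  shows "continuous_on UNIV \<phi>" and "continuous_on UNIV (grad \<phi>)"
proof -
  show "continuous_on UNIV \<phi>"
    using C2_torus_GDERIV[OF assms] unfolding gderiv_def
    by (meson has_derivative_continuous continuous_at_imp_continuous_on)
  show "continuous_on UNIV (grad \<phi>)"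
    by (rule C2_torusE[OF assms])
      (meson has_derivative_continuous continuous_at_imp_continuous_on)
qed

lemma C2_torus_C0: "\<phi> \<in> C2_torus \<Longrightarrow> \<phi> \<in> C0_torus"
  using C2_torus_continuous(1) unfolding C0_torus_def C2_torus_def by blast

text \<open>The Jacobian of the gradient is continuous and periodic, hence bounded, so the gradient
  is globally Lipschitz and the remainder is quadratic uniformly in \<open>x\<close>. One constant
  serves both bounds to keep later estimates short.\<close>

lemma C2_torus_taylor:
  assumes "\<phi> \<in> C2_torus"
  obtains C where "C > 0" "\<And>x. \<bar>\<phi> x\<bar> \<le> C"
    "\<And>x h. \<bar>\<phi> (x + h) - \<phi> x - h \<bullet> grad \<phi> x\<bar> \<le> C * (norm h)\<^sup>2"
proof -
  let ?D = "grad \<phi>"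
  have D: "GDERIV \<phi> x :> ?D x" for x using assms by (rule C2_torus_GDERIV)
  obtain D2 :: "real ^ 'a \<Rightarrow> real ^ 'a ^ 'a" where per: "periodic \<phi>"
    and D2: "\<And>x. (?D has_derivative (\<lambda>h. D2 x *v h)) (at x)"
    and D2c: "continuous_on UNIV D2"
    by (rule C2_torusE[OF assms]) (rule that; blast)
  have perD2: "periodic D2" using jacobian_periodic[OF GDERIV_periodic[OF per D] D2] .
  obtain B0 where B0: "B0 > 0" "\<And>x. norm (\<phi> x) \<le> B0" using periodic_bounded[OF per C2_torus_continuous(1)[OF assms]] by blast
  obtain B2 where B2: "B2 > 0" "\<And>x. norm (D2 x) \<le> B2" using periodic_bounded[OF perD2 D2c] by blast
  define L where "L = real CARD('a) * B2"
  have "L > 0" using B2 by (simp add: L_def)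
  have Lip: "norm (?D y - ?D x) \<le> L * norm (y - x)" for x y
  proof (rule differentiable_bound[where S = UNIV and f' = "\<lambda>x h. D2 x *v h"])
    show "onorm ((*v) (D2 z)) \<le> L" for z
    proof (rule onorm_le)
      fix h
      have "norm (D2 z *v h) \<le> real CARD('a) * norm (D2 z) * norm h" by (rule matrix_vector_norm_le)
      also have "\<dots> \<le> L * norm h"
        unfolding L_def using B2 by (intro mult_right_mono mult_left_mono) auto
      finally show "norm (D2 z *v h) \<le> L * norm h" .
    qed
  qed (use D2 has_derivative_at_withinI in auto)
  have T: "\<bar>\<phi> (x + h) - \<phi> x - h \<bullet> ?D x\<bar> \<le> L * (norm h)\<^sup>2" for x h
  proof -
    let ?S = "cball x (norm h)"
    \<comment> \<open>Mean value inequality for \<open>\<phi>\<close> minus its linear part at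
      \<open>x\<close>: on the ball of radius \<open>norm h\<close> the derivative of the difference
      is at most \<open>L * norm h\<close>.\<close>
    have "norm ((\<phi> (x + h) - (x + h) \<bullet> ?D x) - (\<phi> x - x \<bullet> ?D x)) \<le> L * norm h * norm ((x + h) - x)"
    proof (rule differentiable_bound[where S = ?S and f' = "\<lambda>y v. v \<bullet> (?D y - ?D x)" and f = "\<lambda>y. \<phi> y - y \<bullet> ?D x"])
      fix y assume y: "y \<in> ?S"
      show "((\<lambda>y. \<phi> y - y \<bullet> ?D x) has_derivative (\<lambda>v. v \<bullet> (?D y - ?D x))) (at y within ?S)"
        unfolding inner_diff_right
        by (intro has_derivative_diff has_derivative_inner_left has_derivative_ident
            has_derivative_at_withinI[OF D[of y, unfolded gderiv_def]])
      show "onorm (\<lambda>v. v \<bullet> (?D y - ?D x)) \<le> L * norm h"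
      proof (rule onorm_le)
        fix v
        have "norm (v \<bullet> (?D y - ?D x)) \<le> norm v * norm (?D y - ?D x)" by (simp add: Cauchy_Schwarz_ineq2)
        also have "\<dots> \<le> norm v * (L * norm (y - x))" by (intro mult_left_mono Lip) auto
        also have "\<dots> \<le> norm v * (L * norm h)"
          using y \<open>L > 0\<close> by (intro mult_left_mono) (auto simp: dist_norm norm_minus_commute)
        finally show "norm (v \<bullet> (?D y - ?D x)) \<le> L * norm h * norm v" by (simp add: mult_ac)
      qed
    qed (auto simp: dist_norm)
    moreover have "(\<phi> (x + h) - (x + h) \<bullet> ?D x) - (\<phi> x - x \<bullet> ?D x) = \<phi> (x + h) - \<phi> x - h \<bullet> ?D x"
      by (simp add: inner_add_left)
    ultimately show ?thesis by (simp add: power2_eq_square mult.assoc)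
  qed
  show thesis
  proof (rule that[of "B0 + L"])
    show "B0 + L > 0" using B0 \<open>L > 0\<close> by simp
    show "\<bar>\<phi> x\<bar> \<le> B0 + L" for x using B0(2)[of x] \<open>L > 0\<close> by simp
    show "\<bar>\<phi> (x + h) - \<phi> x - h \<bullet> ?D x\<bar> \<le> (B0 + L) * (norm h)\<^sup>2" for x h
      using T[of x h] mult_nonneg_nonneg[OF less_imp_le[OF B0(1)] zero_le_power2[of "norm h"]]
      unfolding distrib_right by linarith
  qed
qed

lemma C2_torus_const: "(\<lambda>x. a) \<in> C2_torus"
  by (rule C2_torusI[where D = "\<lambda>x. 0" and J = "\<lambda>x. 0"])
     (auto simp: periodic_def GDERIV_const)

lemma C2_torus_lincomb:
  assumes "\<phi> \<in> C2_torus" "\<psi> \<in> C2_torus"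
  shows "(\<lambda>x. a * \<phi> x + b * \<psi> x) \<in> C2_torus"
    and "grad (\<lambda>x. a * \<phi> x + b * \<psi> x) x = a *\<^sub>R grad \<phi> x + b *\<^sub>R grad \<psi> x"
proof -
  have G: "GDERIV (\<lambda>x. a * \<phi> x + b * \<psi> x) x :> a *\<^sub>R grad \<phi> x + b *\<^sub>R grad \<psi> x" for x
    using C2_torus_GDERIV[OF assms(1), of x] C2_torus_GDERIV[OF assms(2), of x] unfolding gderiv_def
    by (auto intro!: derivative_eq_intros simp: inner_add_right)
  then show "grad (\<lambda>x. a * \<phi> x + b * \<psi> x) x = a *\<^sub>R grad \<phi> x + b *\<^sub>R grad \<psi> x"
    by (rule grad_eqI)
  obtain P where P: "periodic \<phi>" "\<And>x. (grad \<phi> has_derivative (\<lambda>h. P x *v h)) (at x)" "continuous_on UNIV P"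
    using C2_torusE[OF assms(1)] by blast
  obtain Q where Q: "periodic \<psi>" "\<And>x. (grad \<psi> has_derivative (\<lambda>h. Q x *v h)) (at x)" "continuous_on UNIV Q"
    using C2_torusE[OF assms(2)] by blast
  show "(\<lambda>x. a * \<phi> x + b * \<psi> x) \<in> C2_torus"
  proof (rule C2_torusI[OF _ G, where J = "\<lambda>x. a *\<^sub>R P x + b *\<^sub>R Q x"])
    show "periodic (\<lambda>x. a * \<phi> x + b * \<psi> x)" using P(1) Q(1) unfolding periodic_def by auto
    show "((\<lambda>x. a *\<^sub>R grad \<phi> x + b *\<^sub>R grad \<psi> x) has_derivative (*v) (a *\<^sub>R P x + b *\<^sub>R Q x)) (at x)" for x
      unfolding matrix_vector_mult_add_rdistrib scaleR_matrix_vector_assoc[symmetric]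
      by (intro has_derivative_add has_derivative_scaleR_right P(2) Q(2))
    show "continuous_on UNIV (\<lambda>x. a *\<^sub>R P x + b *\<^sub>R Q x)" by (intro continuous_intros P Q)
  qed
qed

lemma C2_torus_compose:
  assumes \<phi>: "\<phi> \<in> C2_torus"
    and \<theta>: "\<And>t. (\<theta> has_real_derivative \<theta>' t) (at t)" "\<And>t. (\<theta>' has_real_derivative \<theta>'' t) (at t)"
      "continuous_on UNIV \<theta>''"
  shows "(\<lambda>x. \<theta> (\<phi> x)) \<in> C2_torus"
proof -
  obtain P where P: "periodic \<phi>" "\<And>x. (grad \<phi> has_derivative (\<lambda>h. P x *v h)) (at x)" "continuous_on UNIV P"
    using C2_torusE[OF \<phi>] by blast
  have G: "(\<phi> has_derivative (\<lambda>h. h \<bullet> grad \<phi> x)) (at x)" for x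
    using C2_torus_GDERIV[OF \<phi>] by (simp add: gderiv_def)
  have cont: "continuous_on UNIV \<phi>" "continuous_on UNIV (grad \<phi>)" "continuous_on UNIV \<theta>'"
    using C2_torus_continuous[OF \<phi>] \<theta>(2) DERIV_isCont continuous_at_imp_continuous_on by blast+
  show ?thesis
  proof (rule C2_torusI[where D = "\<lambda>x. \<theta>' (\<phi> x) *\<^sub>R grad \<phi> x"
        and J = "\<lambda>x. \<chi> i k. \<theta>'' (\<phi> x) * grad \<phi> x $ i * grad \<phi> x $ k + \<theta>' (\<phi> x) * P x $ i $ k"])
    show "periodic (\<lambda>x. \<theta> (\<phi> x))" using P(1) unfolding periodic_def by auto
    show "GDERIV (\<lambda>x. \<theta> (\<phi> x)) x :> \<theta>' (\<phi> x) *\<^sub>R grad \<phi> x" for x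
      by (rule GDERIV_DERIV_compose[OF C2_torus_GDERIV[OF \<phi>] \<theta>(1)])
    show "((\<lambda>x. \<theta>' (\<phi> x) *\<^sub>R grad \<phi> x) has_derivative
       (*v) (\<chi> i k. \<theta>'' (\<phi> x) * grad \<phi> x $ i * grad \<phi> x $ k + \<theta>' (\<phi> x) * P x $ i $ k)) (at x)" for x
    proof -
      have "((\<lambda>x. \<theta>' (\<phi> x)) has_derivative (\<lambda>h. (h \<bullet> grad \<phi> x) * \<theta>'' (\<phi> x))) (at x)"
        by (rule has_derivative_compose[OF G, where g = \<theta>', simplified])
          (use \<theta>(2) in \<open>simp add: has_field_derivative_def mult_commute_abs\<close>)
      then have "((\<lambda>x. \<theta>' (\<phi> x) *\<^sub>R grad \<phi> x) has_derivative
         (\<lambda>h. \<theta>' (\<phi> x) *\<^sub>R (P x *v h) + ((h \<bullet> grad \<phi> x) * \<theta>'' (\<phi> x)) *\<^sub>R grad \<phi> x)) (at x)"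
        by (rule has_derivative_scaleR[OF _ P(2)])
      then show ?thesis
        by (rule has_derivative_eq_rhs)
          (auto simp: fun_eq_iff vec_eq_iff matrix_vector_mult_def inner_vec_def algebra_simps
            sum.distrib sum_distrib_left sum_distrib_right intro!: sum.cong)
    qed
    show "continuous_on UNIV (\<lambda>x. \<chi> i k. \<theta>'' (\<phi> x) * grad \<phi> x $ i * grad \<phi> x $ k + \<theta>' (\<phi> x) * P x $ i $ k)"
      by (intro continuous_intros P cont continuous_on_compose2[OF \<theta>(3) cont(1)]
          continuous_on_compose2[OF cont(3) cont(1)]) auto
  qed
qed

section \<open>A periodic penalty\<close>

text \<open>On this interval sine is concave, so its graph lies above the chord joining the
  endpoints.\<close>

lemma Jordan_sin_ge:
  fixes s :: real
  assumes "0 \<le> s" "s \<le> pi / 2"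
  shows "2 / pi * s \<le> sin s"
proof -
  have conc: "concave_on {0..pi/2} sin"
  proof (rule f''_le0_imp_concave[where f' = cos and f'' = "\<lambda>x. - sin x"])
    show "- sin x \<le> 0" if "x \<in> {0..pi/2}" for x :: real
      using that sin_ge_zero[of x] by simp
  qed (auto intro: derivative_eq_intros)
  have "(1 - 2 / pi * s) * sin 0 + (2 / pi * s) * sin (pi / 2)
      \<le> sin ((1 - 2 / pi * s) *\<^sub>R 0 + (2 / pi * s) *\<^sub>R (pi / 2))"
    using assms by (intro concave_onD[OF conc]) (auto simp: field_simps)
  then show ?thesis by simp
qed

text \<open>A smooth periodic substitute for |h|^2. The squared distance of the torus itself is not
  differentiable across the faces of the cell, so it could not serve as a test function.\<close>

definition trig_gap :: "real ^ 'n::finite \<Rightarrow> real" where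
  "trig_gap h = (\<Sum>i\<in>UNIV. 1 - cos (2 * pi * h $ i))"

definition trig_gap_grad :: "real ^ 'n::finite \<Rightarrow> real ^ 'n" where
  "trig_gap_grad h = (\<chi> i. 2 * pi * sin (2 * pi * h $ i))"

lemma trig_gap_nonneg: "0 \<le> trig_gap h"
  unfolding trig_gap_def by (intro sum_nonneg) simp

lemma trig_gap_0 [simp]: "trig_gap 0 = 0"
  by (simp add: trig_gap_def)

lemma trig_gap_minus: "trig_gap (- h) = trig_gap h"
  by (simp add: trig_gap_def)

lemma trig_gap_commute: "trig_gap (x - y) = trig_gap (y - x)"
  using trig_gap_minus[of "x - y"] by simp

lemma trig_gap_grad_commute: "trig_gap_grad (x - y) = - trig_gap_grad (y - x)"
  unfolding trig_gap_grad_def vec_eq_iff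
proof
  fix i
  have "sin (2 * pi * (x $ i - y $ i)) = - sin (2 * pi * (y $ i - x $ i))"
    using sin_minus[of "2 * pi * (y $ i - x $ i)"] by (simp add: algebra_simps)
  then show "(\<chi> i. 2 * pi * sin (2 * pi * (x - y) $ i)) $ i
      = (- (\<chi> i. 2 * pi * sin (2 * pi * (y - x) $ i))) $ i" by simp
qed

lemma cos_2pi_shift: "k \<in> \<int> \<Longrightarrow> cos (2 * pi * (t + k)) = cos (2 * pi * t)"
proof -
  assume "k \<in> \<int>"
  then obtain n where n: "k = of_int n" by (rule Ints_cases)
  have "cos (2 * pi * of_int n) = 1" "sin (2 * pi * of_int n) = 0"
    by (rule cos_int_2pin, rule sin_int_2pin)
  then show ?thesis by (simp add: n distrib_left cos_add)
qed

lemma periodic_trig_gap: "periodic trig_gap"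
  unfolding periodic_def trig_gap_def by (simp add: cos_2pi_shift)

text \<open>The identity 1 - cos(2 pi t) = 2 sin^2(pi t) together with sin(pi |t|) >= 2 |t| for |t|
  <= 1/2 gives the factor 8 in each coordinate.\<close>

lemma trig_gap_lower:
  assumes "h \<in> unit_cell"
  shows "8 * (norm h)\<^sup>2 \<le> trig_gap h"
proof -
  have "8 * t\<^sup>2 \<le> 1 - cos (2 * pi * t)" if "\<bar>t\<bar> \<le> 1 / 2" for t :: real
  proof -
    have "2 * \<bar>t\<bar> = 2 / pi * (pi * \<bar>t\<bar>)" by simp
    also have "\<dots> \<le> sin (pi * \<bar>t\<bar>)"
      using that by (intro Jordan_sin_ge) (auto simp: field_simps)
    finally have "(2 * \<bar>t\<bar>)\<^sup>2 \<le> (sin (pi * \<bar>t\<bar>))\<^sup>2" by (intro power_mono) auto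
    moreover have "1 - cos (2 * pi * t) = 2 * (sin (pi * \<bar>t\<bar>))\<^sup>2"
      using cos_double_sin[of "pi * t"] by (cases "t \<ge> 0") (simp_all add: mult.assoc)
    ultimately show ?thesis by (simp add: power2_eq_square)
  qed
  then have "(\<Sum>i\<in>UNIV. 8 * (h $ i)\<^sup>2) \<le> trig_gap h"
    using assms unfolding trig_gap_def unit_cell_def by (intro sum_mono) auto
  moreover have "(norm h)\<^sup>2 = (\<Sum>i\<in>UNIV. (h $ i)\<^sup>2)"
    by (simp add: norm_vec_def L2_set_def sum_nonneg)
  ultimately show ?thesis by (simp add: sum_distrib_left)
qed

lemma norm_trig_gap_grad_le: "norm (trig_gap_grad h) \<le> 4 * pi\<^sup>2 * norm h"
proof -
  have "norm (trig_gap_grad h) \<le> norm ((4 * pi\<^sup>2) *\<^sub>R h)"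
  proof (rule norm_le_componentwise_cart)
    fix i
    have "\<bar>2 * pi * sin (2 * pi * h $ i)\<bar> \<le> 2 * pi * \<bar>2 * pi * h $ i\<bar>"
      using abs_sin_x_le_abs_x[of "2 * pi * h $ i"] by (simp add: abs_mult)
    then show "norm (trig_gap_grad h $ i) \<le> norm (((4 * pi\<^sup>2) *\<^sub>R h) $ i)"
      by (simp add: trig_gap_grad_def abs_mult power2_eq_square)
  qed
  then show ?thesis by simp
qed

lemma has_derivative_component_diff:
  "((\<lambda>x. (x - y) $ i) has_derivative (\<lambda>h. h $ i)) (at (x :: real ^ 'n::finite))"
  using bounded_linear.has_derivative[OF bounded_linear_vec_nth
      has_derivative_diff[OF has_derivative_ident has_derivative_const]] by simp

lemma GDERIV_trig_gap: "GDERIV (\<lambda>x. trig_gap (x - y)) x :> trig_gap_grad (x - y)"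
  unfolding gderiv_def trig_gap_def trig_gap_grad_def inner_vec_def
  by (rule has_derivative_component_diff derivative_eq_intros refl)+ (auto simp: fun_eq_iff sum_negf[symmetric] mult_ac intro!: sum.cong)

lemma grad_trig_gap: "grad (\<lambda>x. trig_gap (x - y)) x = trig_gap_grad (x - y)"
  by (rule grad_eqI[OF GDERIV_trig_gap])

lemma C2_torus_trig_gap: "(\<lambda>x. trig_gap (x - y)) \<in> C2_torus"
proof (rule C2_torusI[OF _ GDERIV_trig_gap,
      where J = "\<lambda>x. \<chi> i k. if i = k then 4 * pi\<^sup>2 * cos (2 * pi * (x - y) $ i) else 0"])
  show "periodic (\<lambda>x. trig_gap (x - y))"
    using periodicD[OF periodic_trig_gap] unfolding periodic_def
    by (metis add_diff_eq diff_add_eq)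
  show "((\<lambda>x. trig_gap_grad (x - y)) has_derivative
      (*v) (\<chi> i k. if i = k then 4 * pi\<^sup>2 * cos (2 * pi * (x - y) $ i) else 0)) (at x)" for x
  proof -
    have 1: "((\<lambda>x. 2 * pi * sin (2 * pi * (x - y) $ i)) has_derivative
        (\<lambda>h. 4 * pi\<^sup>2 * cos (2 * pi * (x - y) $ i) * h $ i)) (at x)" for i
      by (rule has_derivative_component_diff derivative_eq_intros refl)+ (auto simp: fun_eq_iff power2_eq_square)
    have 2: "(\<chi> i k. if i = k then 4 * pi\<^sup>2 * cos (2 * pi * (x - y) $ i) else 0) *v h
        = (\<chi> i. 4 * pi\<^sup>2 * cos (2 * pi * (x - y) $ i) * h $ i)" for h
      unfolding matrix_vector_mult_def vec_eq_iff
      by (auto simp: if_distrib[where f = "\<lambda>a. a * _"] cong: if_cong)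
    show ?thesis
      unfolding 2 trig_gap_grad_def
      by (subst has_derivative_componentwise_within) (use 1 in \<open>auto simp: Basis_vec_def inner_axis\<close>)
  qed
  show "continuous_on UNIV (\<lambda>x. \<chi> i k. if i = k then 4 * pi\<^sup>2 * cos (2 * pi * (x - y) $ i) else 0)"
  proof (intro continuous_on_vec_lambda)
    show "continuous_on UNIV (\<lambda>x. if i = k then 4 * pi\<^sup>2 * cos (2 * pi * (x - y) $ i) else 0)" for i k
      by (cases "i = k") (auto intro!: continuous_intros)
  qed
qed

section \<open>Smooth approximation from above\<close>

text \<open>A regularization of \<open>max 0 t\<close> from below. The cube makes it C^2 across 0,
  and \<open>s\<close> bounds the loss.\<close>

definition smooth_pos_part :: "real \<Rightarrow> real \<Rightarrow> real" where
  "smooth_pos_part s t = (max 0 t) ^ 3 / (t\<^sup>2 + s\<^sup>2)"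

lemma DERIV_pos_part_power:
  "((\<lambda>t. (max 0 t) ^ Suc (Suc n)) has_real_derivative (real (Suc (Suc n)) * (max 0 t) ^ Suc n)) (at t)"
proof -
  consider "t < 0" | "t > 0" | "t = 0" by linarith
  then show ?thesis
  proof cases
    case 1
    have "((\<lambda>t. 0) has_real_derivative real (Suc (Suc n)) * (max 0 t) ^ Suc n) (at t)"
      using 1 by simp
    then show ?thesis
      by (rule has_field_derivative_transform_within_open[where S = "{..<0}"]) (use 1 in auto)
  next
    case 2
    have "((\<lambda>t. t ^ Suc (Suc n)) has_real_derivative real (Suc (Suc n)) * t ^ Suc n) (at t)"
      by (auto intro!: derivative_eq_intros simp del: power_Suc)
    then have "((\<lambda>t. t ^ Suc (Suc n)) has_real_derivative real (Suc (Suc n)) * (max 0 t) ^ Suc n) (at t)"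
      using 2 by simp
    then show ?thesis
      by (rule has_field_derivative_transform_within_open[where S = "{0<..}"]) (use 2 in auto)
  next
    case 3
    \<comment> \<open>At the kink the difference quotient is bounded by a positive power of |h|;
      this is why the exponent starts at 2.\<close>
    have "((\<lambda>h::real. (max 0 h) ^ Suc (Suc n) / h) \<longlongrightarrow> 0) (at 0)"
    proof (rule Lim_null_comparison)
      show "\<forall>\<^sub>F h::real in at 0. norm ((max 0 h) ^ Suc (Suc n) / h) \<le> \<bar>h\<bar> ^ Suc n"
      proof (intro always_eventually allI)
        show "norm ((max 0 h) ^ Suc (Suc n) / h) \<le> \<bar>h\<bar> ^ Suc n" for h :: real
          by (cases "h > 0") (simp_all add: mult_nonpos_nonneg)
      qed
      have "((\<lambda>h::real. \<bar>h\<bar> ^ Suc n) \<longlongrightarrow> \<bar>0\<bar> ^ Suc n) (at 0)" by (intro tendsto_intros)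
      then show "((\<lambda>h::real. \<bar>h\<bar> ^ Suc n) \<longlongrightarrow> 0) (at 0)" by simp
    qed
    then show ?thesis using 3 by (simp add: DERIV_def)
  qed
qed

text \<open>The deficit is \<open>max 0 t * s^2 / (t^2 + s^2)\<close>, and 2 t s <= t^2 + s^2 bounds
  it by \<open>s\<close>. Both one-sided bounds matter below: nonnegativity keeps the smoothed
  minimum below \<open>g\<close>, and the bound by \<open>max 0 t\<close> keeps it above
  \<open>u\<close>.\<close>

lemma smooth_pos_part_bounds:
  assumes "s > 0"
  shows "0 \<le> smooth_pos_part s t" "smooth_pos_part s t \<le> max 0 t" "max 0 t - s \<le> smooth_pos_part s t"
proof -
  have pos: "t\<^sup>2 + s\<^sup>2 > 0" using assms by (simp add: add_nonneg_pos)
  show "0 \<le> smooth_pos_part s t" using pos by (simp add: smooth_pos_part_def)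
  have eq: "max 0 t - smooth_pos_part s t = max 0 t * s\<^sup>2 / (t\<^sup>2 + s\<^sup>2)"
    using pos by (cases "t > 0") (auto simp: smooth_pos_part_def field_simps power3_eq_cube power2_eq_square)
  have "max 0 t * s\<^sup>2 / (t\<^sup>2 + s\<^sup>2) \<ge> 0" using pos by simp
  then show "smooth_pos_part s t \<le> max 0 t" using eq by linarith
  have "max 0 t * s \<le> t\<^sup>2 + s\<^sup>2"
  proof (cases "t > 0")
    case True
    have "0 \<le> (t - s)\<^sup>2" by simp
    then have "2 * (t * s) \<le> t\<^sup>2 + s\<^sup>2" by (simp add: power2_diff)
    moreover have "0 \<le> t * s" using True assms by simp
    ultimately show ?thesis using True by simp
  qed simp
  then have "s * (max 0 t * s) \<le> s * (t\<^sup>2 + s\<^sup>2)" using assms by (intro mult_left_mono) auto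
  then have "max 0 t * s\<^sup>2 / (t\<^sup>2 + s\<^sup>2) \<le> s"
    using pos by (simp add: field_simps power2_eq_square)
  then show "max 0 t - s \<le> smooth_pos_part s t" using eq by linarith
qed

lemma C2_torus_smooth_pos_part:
  assumes "\<phi> \<in> C2_torus" "s > 0"
  shows "(\<lambda>x. smooth_pos_part s (\<phi> x)) \<in> C2_torus"
proof -
  have pos: "t\<^sup>2 + s\<^sup>2 > 0" for t using assms(2) by (simp add: add_nonneg_pos)
  have d3: "((\<lambda>t. (max 0 t) ^ 3) has_real_derivative (3 * (max 0 t)\<^sup>2)) (at t)" for t :: real
    using DERIV_pos_part_power[of 1 t] by (simp add: numeral_eq_Suc)
  have d2: "((\<lambda>t. (max 0 t)\<^sup>2) has_real_derivative (2 * max 0 t)) (at t)" for t :: real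
    using DERIV_pos_part_power[of 0 t] by (simp add: numeral_eq_Suc)
  have nz: "t\<^sup>2 + s\<^sup>2 \<noteq> 0" for t using pos[of t] by linarith
  \<comment> \<open>The quotient rule is put in the form A / D - B / D^2 so that the same rule can
    be applied to each term again for the second derivative.\<close>
  have quot: "D \<noteq> 0 \<Longrightarrow> (A * D - B) / (D * D) = A / D - B / D\<^sup>2" for A B D :: real
    by (simp add: diff_divide_distrib power2_eq_square)
  have dA: "((\<lambda>t. 3 * (max 0 t)\<^sup>2) has_real_derivative 6 * max 0 t) (at t)" for t :: real
    using DERIV_cmult[OF d2, of 3 t] by simp
  have dB: "((\<lambda>t. (max 0 t) ^ 3 * (2 * t)) has_real_derivative
      3 * (max 0 t)\<^sup>2 * (2 * t) + (max 0 t) ^ 3 * 2) (at t)" for t :: real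
    by (rule derivative_eq_intros d3 refl)+ simp
  have dD: "((\<lambda>t. t\<^sup>2 + s\<^sup>2) has_real_derivative 2 * t) (at t)" for t :: real
    by (rule derivative_eq_intros refl)+ simp
  have dE: "((\<lambda>t. (t\<^sup>2 + s\<^sup>2)\<^sup>2) has_real_derivative 2 * (t\<^sup>2 + s\<^sup>2) * (2 * t)) (at t)" for t :: real
    by (rule derivative_eq_intros refl)+ simp
  have nz2: "(t\<^sup>2 + s\<^sup>2)\<^sup>2 \<noteq> 0" for t using nz[of t] by simp
  show ?thesis
    unfolding smooth_pos_part_def
  proof (rule C2_torus_compose[OF assms(1), where
        \<theta>' = "\<lambda>t. 3 * (max 0 t)\<^sup>2 / (t\<^sup>2 + s\<^sup>2) - (max 0 t) ^ 3 * (2 * t) / (t\<^sup>2 + s\<^sup>2)\<^sup>2" and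
        \<theta>'' = "\<lambda>t. 6 * max 0 t / (t\<^sup>2 + s\<^sup>2) - 3 * (max 0 t)\<^sup>2 * (2 * t) / (t\<^sup>2 + s\<^sup>2)\<^sup>2
          - ((3 * (max 0 t)\<^sup>2 * (2 * t) + (max 0 t) ^ 3 * 2) / (t\<^sup>2 + s\<^sup>2)\<^sup>2
             - (max 0 t) ^ 3 * (2 * t) * (2 * (t\<^sup>2 + s\<^sup>2) * (2 * t)) / ((t\<^sup>2 + s\<^sup>2)\<^sup>2)\<^sup>2)"])
    show "((\<lambda>t. (max 0 t) ^ 3 / (t\<^sup>2 + s\<^sup>2)) has_real_derivative
        3 * (max 0 t)\<^sup>2 / (t\<^sup>2 + s\<^sup>2) - (max 0 t) ^ 3 * (2 * t) / (t\<^sup>2 + s\<^sup>2)\<^sup>2) (at t)" for t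
      using DERIV_divide[OF d3 dD nz, of t] unfolding quot[OF nz] .
    show "((\<lambda>t. 3 * (max 0 t)\<^sup>2 / (t\<^sup>2 + s\<^sup>2) - (max 0 t) ^ 3 * (2 * t) / (t\<^sup>2 + s\<^sup>2)\<^sup>2) has_real_derivative
       6 * max 0 t / (t\<^sup>2 + s\<^sup>2) - 3 * (max 0 t)\<^sup>2 * (2 * t) / (t\<^sup>2 + s\<^sup>2)\<^sup>2
          - ((3 * (max 0 t)\<^sup>2 * (2 * t) + (max 0 t) ^ 3 * 2) / (t\<^sup>2 + s\<^sup>2)\<^sup>2
             - (max 0 t) ^ 3 * (2 * t) * (2 * (t\<^sup>2 + s\<^sup>2) * (2 * t)) / ((t\<^sup>2 + s\<^sup>2)\<^sup>2)\<^sup>2)) (at t)" for t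
      using DERIV_diff[OF DERIV_divide[OF dA dD nz] DERIV_divide[OF dB dE nz2], of t]
      unfolding quot[OF nz] quot[OF nz2] .
    show "continuous_on UNIV (\<lambda>t. 6 * max 0 t / (t\<^sup>2 + s\<^sup>2) - 3 * (max 0 t)\<^sup>2 * (2 * t) / (t\<^sup>2 + s\<^sup>2)\<^sup>2
          - ((3 * (max 0 t)\<^sup>2 * (2 * t) + (max 0 t) ^ 3 * 2) / (t\<^sup>2 + s\<^sup>2)\<^sup>2
             - (max 0 t) ^ 3 * (2 * t) * (2 * (t\<^sup>2 + s\<^sup>2) * (2 * t)) / ((t\<^sup>2 + s\<^sup>2)\<^sup>2)\<^sup>2))"
      using nz by (intro continuous_intros) auto
  qed
qed

text \<open>min(g, b) = g - (g - b)^+, with the positive part replaced by its smooth lower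
  approximation.\<close>

lemma C2_torus_smooth_min:
  assumes g: "g \<in> C2_torus" "\<And>x. u x \<le> g x" and b: "b \<in> C2_torus" "\<And>x. u x \<le> b x" and "s > 0"
  obtains \<phi> where "\<phi> \<in> C2_torus" "\<And>x. u x \<le> \<phi> x" "\<And>x. \<phi> x \<le> g x" "\<And>x. \<phi> x \<le> b x + s"
proof
  let ?d = "\<lambda>x. 1 * g x + (- 1) * b x"
  let ?\<phi> = "\<lambda>x. 1 * g x + (- 1) * smooth_pos_part s (?d x)"
  show "?\<phi> \<in> C2_torus"
    by (intro C2_torus_lincomb C2_torus_smooth_pos_part g b \<open>s > 0\<close>)
  fix x
  show "u x \<le> ?\<phi> x" "?\<phi> x \<le> g x" "?\<phi> x \<le> b x + s"
    using smooth_pos_part_bounds[OF \<open>s > 0\<close>, of "?d x"] g(2)[of x] b(2)[of x] by auto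
qed

text \<open>The error stays \<open>s\<close> however large \<open>I\<close> is: each further step
  only lowers the function, so bounds already obtained persist.\<close>

lemma C2_torus_smooth_Min:
  assumes "finite I" and g: "g \<in> C2_torus" "\<And>x. u x \<le> g x"
    and b: "\<And>i. i \<in> I \<Longrightarrow> b i \<in> C2_torus" "\<And>i x. i \<in> I \<Longrightarrow> u x \<le> b i x" and "s > 0"
  shows "\<exists>\<phi>\<in>C2_torus. (\<forall>x. u x \<le> \<phi> x) \<and> (\<forall>x. \<phi> x \<le> g x) \<and> (\<forall>i\<in>I. \<forall>x. \<phi> x \<le> b i x + s)"
  using \<open>finite I\<close> b
proof (induction I rule: finite_induct)
  case empty
  then show ?case using g by auto
next
  case (insert i I)
  then obtain \<phi> where \<phi>: "\<phi> \<in> C2_torus" "\<And>x. u x \<le> \<phi> x" "\<And>x. \<phi> x \<le> g x"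
      "\<And>k x. k \<in> I \<Longrightarrow> \<phi> x \<le> b k x + s"
    by (metis (lifting) insert_iff)
  obtain \<psi> where "\<psi> \<in> C2_torus" "\<And>x. u x \<le> \<psi> x" "\<And>x. \<psi> x \<le> \<phi> x" "\<And>x. \<psi> x \<le> b i x + s"
    using C2_torus_smooth_min[OF \<phi>(1,2), of "b i" s] insert.prems \<open>s > 0\<close> by (metis insertI1)
  moreover from this have "\<psi> x \<le> g x" "k \<in> I \<Longrightarrow> \<psi> x \<le> b k x + s" for k x
    using \<phi>(3,4) by (meson order_trans)+
  ultimately show ?case by blast
qed

text \<open>A Lipschitz \<open>u\<close> is, up to a small error, the infimum of smooth caps
  \<open>b y\<close> lying above it. Compactness of the cell leaves finitely many caps, and their
  smoothed minimum with \<open>g\<close> is the required function.\<close>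

lemma C2_torus_approx_from_above:
  fixes u :: "real ^ 'n::finite \<Rightarrow> real"
  assumes per: "periodic u" and lip: "\<kappa>-lipschitz_on UNIV u"
    and g: "g \<in> C2_torus" "\<And>x. u x \<le> g x" and s: "s > 0"
  obtains \<phi> where "\<phi> \<in> C2_torus" "\<And>x. u x \<le> \<phi> x" "\<And>x. \<phi> x \<le> g x" "\<And>x. \<phi> x \<le> u x + s"
proof -
  \<comment> \<open>The curvature \<open>\<kappa>^2 / s\<close> and the lift \<open>s / 4\<close>
    are those of the inequality \<kappa> r <= s/4 + (\<kappa>^2 / s) r^2, i.e. (\<kappa> r - s/2)^2
    >= 0. At its centre the cap exceeds \<open>u\<close> by only \<open>s / 4\<close>, so it stays
    within \<open>s / 2\<close> nearby; smoothing spends the other \<open>s / 2\<close>.\<close>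
  define b where "b y x = \<kappa>\<^sup>2 / s * trig_gap (x - y) + 1 * (u y + s / 4)" for y x :: "real ^ 'n"
  have b: "b y \<in> C2_torus" for y
    unfolding b_def by (intro C2_torus_lincomb C2_torus_trig_gap C2_torus_const)
  have ub: "u x \<le> b y x" for x y
  proof -
    obtain k where k: "\<And>i. k $ i \<in> \<int>" "x - y + k \<in> unit_cell" using shift_into_unit_cell by blast
    define r where "r = norm (x - y + k)"
    have "\<bar>u (x + k) - u y\<bar> \<le> \<kappa> * r"
      using lipschitz_onD[OF lip, of "x + k" y] by (simp add: dist_norm r_def algebra_simps)
    moreover have "u (x + k) = u x" using periodicD[OF per] k by blast
    ultimately have 1: "u x \<le> u y + \<kappa> * r" by linarith
    have "0 \<le> (\<kappa> * r - s / 2)\<^sup>2 / s" using s by simp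
    then have 2: "\<kappa> * r \<le> s / 4 + \<kappa>\<^sup>2 / s * r\<^sup>2"
      using s by (simp add: field_simps power2_eq_square)
    have "r\<^sup>2 \<le> 8 * r\<^sup>2" by simp
    also have "\<dots> \<le> trig_gap (x - y + k)" unfolding r_def by (rule trig_gap_lower) (rule k)
    also have "\<dots> = trig_gap (x - y)" using periodicD[OF periodic_trig_gap] k by blast
    finally have "\<kappa>\<^sup>2 / s * r\<^sup>2 \<le> \<kappa>\<^sup>2 / s * trig_gap (x - y)" using s by (intro mult_left_mono) auto
    then show ?thesis using 1 2 by (simp add: b_def)
  qed
  have cu: "continuous_on UNIV u" using lip by (rule lipschitz_on_continuous_on)
  have cb: "continuous_on UNIV (b y)" for y using C2_torus_C0[OF b] by (simp add: C0_torus_def)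
  have op: "open {x. b y x < u x + s / 2}" for y
    by (intro open_Collect_less cb continuous_intros cu)
  have cov: "unit_cell \<subseteq> (\<Union>y\<in>unit_cell. {x. b y x < u x + s / 2})"
  proof
    fix x :: "real ^ 'n" assume "x \<in> unit_cell"
    moreover have "b x x < u x + s / 2" using s by (simp add: b_def)
    ultimately show "x \<in> (\<Union>y\<in>unit_cell. {x. b y x < u x + s / 2})" by blast
  qed
  obtain I where I: "I \<subseteq> unit_cell" "finite I" "unit_cell \<subseteq> (\<Union>y\<in>I. {x. b y x < u x + s / 2})"
    by (rule compactE_image[OF compact_unit_cell op cov]) auto
  obtain \<phi> where \<phi>: "\<phi> \<in> C2_torus" "\<And>x. u x \<le> \<phi> x" "\<And>x. \<phi> x \<le> g x"
      "\<And>y x. y \<in> I \<Longrightarrow> \<phi> x \<le> b y x + s / 2"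
    using C2_torus_smooth_Min[OF I(2) g, of b "s / 2"] b ub s by auto
  have cell: "\<phi> x \<le> u x + s" if x: "x \<in> unit_cell" for x
  proof -
    obtain y where "y \<in> I" "b y x < u x + s / 2" using I(3) x by auto
    then show ?thesis using \<phi>(4)[of y x] by linarith
  qed
  have "\<phi> x \<le> u x + s" for x
  proof -
    obtain k where k: "\<And>i. k $ i \<in> \<int>" "x + k \<in> unit_cell" using shift_into_unit_cell by blast
    have "periodic \<phi>" using C2_torus_C0[OF \<phi>(1)] by (simp add: C0_torus_def)
    then have "\<phi> (x + k) = \<phi> x" "u (x + k) = u x" using per k(1) by (auto intro: periodicD)
    then show ?thesis using cell[OF k(2)] by simp
  qed
  with \<phi> show thesis using that by blast
qed

section \<open>The nonlocal operator\<close>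

lemma le_if_le_add_mult_eps:
  fixes a b T :: real
  assumes "\<And>e. e > 0 \<Longrightarrow> a \<le> b + e * T"
  shows "a \<le> b"
proof (rule field_le_epsilon)
  fix e :: real assume e: "e > 0"
  have "e / (\<bar>T\<bar> + 1) * T \<le> e / (\<bar>T\<bar> + 1) * (\<bar>T\<bar> + 1)"
    using e by (intro mult_left_mono) auto
  then show "a \<le> b + e" using assms[of "e / (\<bar>T\<bar> + 1)"] e by simp
qed

lemma C2_torus_uminus:
  assumes "\<phi> \<in> C2_torus"
  shows "(\<lambda>x. - \<phi> x) \<in> C2_torus" and "grad (\<lambda>x. - \<phi> x) x = - grad \<phi> x"
  using C2_torus_lincomb[OF assms assms, of "-1" 0] by simp_all

lemma C0_torus_uminus: "u \<in> C0_torus \<Longrightarrow> (\<lambda>x. - u x) \<in> C0_torus"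
  unfolding C0_torus_def periodic_def by (auto intro: continuous_on_minus)

lemma C0_torus_diff: "u \<in> C0_torus \<Longrightarrow> v \<in> C0_torus \<Longrightarrow> (\<lambda>x. u x - v x) \<in> C0_torus"
  unfolding C0_torus_def periodic_def by (auto intro: continuous_on_diff)

text \<open>\<open>g - f\<close> has a minimum at \<open>x\<close>. This gives a squeezed test
  function the gradient of the original one at the contact point.\<close>

lemma GDERIV_touching:
  assumes "GDERIV f x :> p" "GDERIV g x :> q" "\<And>y. f y \<le> g y" "f x = g x"
  shows "p = q"
proof -
  have "((\<lambda>y. g y - f y) has_derivative (\<lambda>h. h \<bullet> (q - p))) (at x)"
    using assms(1,2) unfolding gderiv_def inner_diff_right by (intro has_derivative_diff)
  then have "(\<lambda>h. h \<bullet> (q - p)) = (\<lambda>v. 0)"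
    by (rule differential_zero_maxmin[of x UNIV, rotated 2]) (use assms in auto)
  then have "(q - p) \<bullet> (q - p) = 0" by meson
  then show ?thesis by simp
qed

definition levy_weight :: "real ^ 'n::finite \<Rightarrow> real" where
  "levy_weight z = min 1 ((norm z)\<^sup>2)"

lemma levy_weight_nonneg: "0 \<le> levy_weight z"
  by (simp add: levy_weight_def)

lemma levy_weight_inside: "norm z < 1 \<Longrightarrow> levy_weight z = (norm z)\<^sup>2"
  by (simp add: levy_weight_def power_le_one)

lemma levy_weight_outside:
  assumes "\<delta> \<le> norm z" "0 < \<delta>" "\<delta> \<le> 1"
  shows "1 \<le> levy_weight z / \<delta>\<^sup>2"
proof -
  have "\<delta>\<^sup>2 \<le> (norm z)\<^sup>2" "\<delta>\<^sup>2 \<le> 1" using assms by (auto intro: power_mono power_le_one)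
  then show ?thesis using assms by (simp add: levy_weight_def)
qed

text \<open>The tail bound is taken at radius 1, the radius of the compensator: inside that ball
  increments are handled to second order through \<open>j_lipschitz\<close>, outside it no gradient
  term is present.\<close>

locale levy_jumps =
  fixes \<nu> :: "(real ^ 'n::finite) measure"
    and j :: "real ^ 'n \<Rightarrow> real ^ 'n \<Rightarrow> real ^ 'n"
    and Cj Ct :: real
  assumes sets_nu: "sets \<nu> = sets borel"
    and j_measurable: "\<And>x. j x \<in> borel_measurable borel"
    and weight_finite: "(\<integral>\<^sup>+z. ennreal (levy_weight z) \<partial>\<nu>) < \<infinity>"
    and Cj_pos: "Cj > 0"
    and j_bound: "\<And>x z. norm (j x z) \<le> Cj * norm z"
    and j_lipschitz: "\<And>x y z. norm (j x z - j y z) \<le> Cj * norm (x - y) * norm z"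
    and Ct_pos: "Ct > 0"
    and j_tail: "\<And>x y. (\<integral>\<^sup>+z\<in>UNIV - ball 0 1. ennreal (norm (j x z - j y z)) \<partial>\<nu>)
      \<le> ennreal (Ct * norm (x - y))"
begin

lemma measurable_nu: "f \<in> borel_measurable borel \<Longrightarrow> f \<in> borel_measurable \<nu>"
  using measurable_cong_sets[OF sets_nu refl] by blast

lemma levy_weight_measurable: "levy_weight \<in> borel_measurable \<nu>"
  unfolding levy_weight_def by (intro measurable_nu) measurable

lemma levy_weight_integrable: "integrable \<nu> levy_weight"
  using weight_finite levy_weight_measurable
  by (intro integrableI_bounded) (simp_all add: levy_weight_nonneg)

lemma integrable_by_weight:
  assumes "f \<in> borel_measurable \<nu>" "\<And>z. \<bar>f z\<bar> \<le> C * levy_weight z"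
  shows "integrable \<nu> f"
  by (rule Bochner_Integration.integrable_bound[OF integrable_mult_right[OF levy_weight_integrable, of C] assms(1)])
    (use assms(2) in \<open>auto intro: order_trans[OF _ abs_ge_self]\<close>)

text \<open>The gradient slot \<open>q\<close> is independent of \<open>f\<close>, so the
  compensated increment makes sense for a merely continuous \<open>f\<close> with the gradient of a
  test function.\<close>

definition incr :: "(real ^ 'n \<Rightarrow> real) \<Rightarrow> real ^ 'n \<Rightarrow> real ^ 'n \<Rightarrow> real ^ 'n \<Rightarrow> real" where
  "incr f q x z = f (x + j x z) - f x - indicator (ball 0 1) z * (j x z \<bullet> q)"

lemma incr_measurable:
  assumes "continuous_on UNIV f"
  shows "incr f q x \<in> borel_measurable \<nu>"
proof (rule measurable_nu)
  have [measurable]: "f \<in> borel_measurable borel" "j x \<in> borel_measurable borel"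
    using assms j_measurable by (auto intro: borel_measurable_continuous_onI)
  have [measurable]: "(\<lambda>z. j x z \<bullet> q) \<in> borel_measurable borel"
    by (intro borel_measurable_inner j_measurable borel_measurable_const)
  have [measurable]: "ball 0 1 \<in> sets (borel :: (real ^ 'n) measure)" by (intro borel_open open_ball)
  show "incr f q x \<in> borel_measurable borel"
    unfolding incr_def by measurable
qed

lemma nonlocal_op_eq: "nonlocal_op \<nu> j \<phi> x = (\<integral>z. incr \<phi> (grad \<phi> x) x z \<partial>\<nu>)"
  unfolding nonlocal_op_def incr_def ..

lemma j_power2_bound: "(norm (j x z))\<^sup>2 \<le> Cj\<^sup>2 * (norm z)\<^sup>2"
  using power_mono[OF j_bound norm_ge_zero, of x z 2] by (simp add: power_mult_distrib)

text \<open>Second-order Taylor bound inside the unit ball, sup bound outside. The constant does not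
  depend on \<open>x\<close>, which later provides a dominating function along moving
  points.\<close>

lemma incr_C2_bound:
  assumes "\<phi> \<in> C2_torus"
  obtains C where "C > 0" "\<And>x z. \<bar>incr \<phi> (grad \<phi> x) x z\<bar> \<le> C * levy_weight z"
proof -
  obtain C where C: "C > 0" "\<And>x. \<bar>\<phi> x\<bar> \<le> C"
    "\<And>x h. \<bar>\<phi> (x + h) - \<phi> x - h \<bullet> grad \<phi> x\<bar> \<le> C * (norm h)\<^sup>2"
    by (rule C2_torus_taylor[OF assms]) (rule that; blast)
  have "\<bar>incr \<phi> (grad \<phi> x) x z\<bar> \<le> (C * Cj\<^sup>2 + 2 * C) * levy_weight z" for x z
  proof (cases "norm z < 1")
    case True
    have "\<bar>incr \<phi> (grad \<phi> x) x z\<bar> \<le> C * (norm (j x z))\<^sup>2"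
      using C(3)[of x "j x z"] True by (simp add: incr_def)
    also have "\<dots> \<le> C * (Cj\<^sup>2 * (norm z)\<^sup>2)" using C(1) j_power2_bound by (intro mult_left_mono) auto
    also have "\<dots> \<le> (C * Cj\<^sup>2 + 2 * C) * levy_weight z"
      using C(1) True by (simp add: levy_weight_inside distrib_right)
    finally show ?thesis .
  next
    case False
    have "\<bar>incr \<phi> (grad \<phi> x) x z\<bar> \<le> 2 * C"
      using C(2)[of x] C(2)[of "x + j x z"] False by (simp add: incr_def)
    also have "\<dots> \<le> (C * Cj\<^sup>2 + 2 * C) * levy_weight z"
      using C(1) False by (simp add: levy_weight_def)
    finally show ?thesis .
  qed
  then show thesis using that[of "C * Cj\<^sup>2 + 2 * C"] C(1) by (simp add: add_nonneg_pos)
qed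

lemma incr_C2_integrable:
  assumes "\<phi> \<in> C2_torus"
  shows "integrable \<nu> (incr \<phi> (grad \<phi> x) x)"
proof -
  obtain C where C: "C > 0" "\<And>x z. \<bar>incr \<phi> (grad \<phi> x) x z\<bar> \<le> C * levy_weight z"
    by (rule incr_C2_bound[OF assms]) (rule that; blast)
  show ?thesis
    using C2_torus_C0[OF assms] C(2)
    by (intro integrable_by_weight incr_measurable) (auto simp: C0_torus_def)
qed

lemma incr_lincomb:
  "incr (\<lambda>x. a * f x + b * g x) (a *\<^sub>R p + b *\<^sub>R q) x z = a * incr f p x z + b * incr g q x z"
  by (simp add: incr_def inner_add_right algebra_simps)

lemma incr_uminus: "incr (\<lambda>x. - f x) (- q) x z = - incr f q x z"
  by (simp add: incr_def)

lemma nonlocal_op_lincomb: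
  assumes "\<phi> \<in> C2_torus" "\<psi> \<in> C2_torus"
  shows "nonlocal_op \<nu> j (\<lambda>x. a * \<phi> x + b * \<psi> x) x
    = a * nonlocal_op \<nu> j \<phi> x + b * nonlocal_op \<nu> j \<psi> x"
  using incr_C2_integrable[OF assms(1)] incr_C2_integrable[OF assms(2)]
  by (simp add: nonlocal_op_eq C2_torus_lincomb[OF assms] incr_lincomb)

lemma nonlocal_op_uminus:
  assumes "\<phi> \<in> C2_torus"
  shows "nonlocal_op \<nu> j (\<lambda>x. - \<phi> x) x = - nonlocal_op \<nu> j \<phi> x"
  by (simp add: nonlocal_op_eq C2_torus_uminus[OF assms] incr_uminus)

text \<open>Dominated convergence with the uniform multiple of \<open>levy_weight\<close>; pointwise
  convergence comes from the Lipschitz dependence of the jumps on \<open>x\<close>.\<close>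

lemma tendsto_nonlocal_op:
  assumes \<phi>: "\<phi> \<in> C2_torus" and X: "X \<longlonglongrightarrow> x"
  shows "(\<lambda>k. nonlocal_op \<nu> j \<phi> (X k)) \<longlonglongrightarrow> nonlocal_op \<nu> j \<phi> x"
proof -
  obtain C where C: "C > 0" "\<And>x z. \<bar>incr \<phi> (grad \<phi> x) x z\<bar> \<le> C * levy_weight z"
    by (rule incr_C2_bound[OF \<phi>]) (rule that; blast)
  have cont: "continuous_on UNIV \<phi>" "continuous_on UNIV (grad \<phi>)"
    using C2_torus_continuous[OF \<phi>] .
  have lim: "(\<lambda>k. incr \<phi> (grad \<phi> (X k)) (X k) z) \<longlonglongrightarrow> incr \<phi> (grad \<phi> x) x z" for z
  proof -
    have "(\<lambda>k. Cj * norm (X k - x) * norm z) \<longlonglongrightarrow> Cj * norm (x - x) * norm z"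
      by (intro tendsto_intros X)
    then have "(\<lambda>k. j (X k) z - j x z) \<longlonglongrightarrow> 0"
      using Lim_null_comparison[OF always_eventually, of "\<lambda>k. j (X k) z - j x z"
          "\<lambda>k. Cj * norm (X k - x) * norm z"] j_lipschitz by simp
    then have j: "(\<lambda>k. j (X k) z) \<longlonglongrightarrow> j x z" by (rule LIM_zero_cancel)
    show ?thesis
      unfolding incr_def
      by (intro tendsto_intros continuous_on_tendsto_compose[OF cont(1)] 
          continuous_on_tendsto_compose[OF cont(2)] j X) auto
  qed
  show ?thesis
    unfolding nonlocal_op_eq
    by (rule integral_dominated_convergence[where w = "\<lambda>z. C * levy_weight z"])
      (use lim C(2) levy_weight_integrable incr_measurable[OF cont(1)] in auto)
qed

text \<open>The reflection u -> -u, p -> -p exchanges the two notions. Splitting of jumps and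
  stability are thus proved for subsolutions alone; they are stated without convexity because the
  reflected Hamiltonian is concave when \<open>H\<close> is convex.\<close>

lemma supersolution_uminus:
  assumes "viscosity_supersolution \<nu> j H c l u"
  shows "viscosity_subsolution \<nu> j (\<lambda>x p. - H x (- p)) (- c) l (\<lambda>x. - u x)"
  unfolding viscosity_subsolution_def
proof (intro conjI ballI allI impI)
  show "(\<lambda>x. - u x) \<in> C0_torus"
    using assms by (auto simp: viscosity_supersolution_def intro: C0_torus_uminus)
  fix \<phi> :: "real ^ 'n \<Rightarrow> real" and x
  assume \<phi>: "\<phi> \<in> C2_torus" and max: "\<forall>y. - u y - \<phi> y \<le> - u x - \<phi> x"
  have "c \<le> l * u x - nonlocal_op \<nu> j (\<lambda>x. - \<phi> x) x + H x (grad (\<lambda>x. - \<phi> x) x)"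
    using assms max C2_torus_uminus(1)[OF \<phi>]
    unfolding viscosity_supersolution_def by (auto simp: algebra_simps)
  then show "l * - u x - nonlocal_op \<nu> j \<phi> x + - H x (- grad \<phi> x) \<le> - c"
    by (simp add: nonlocal_op_uminus[OF \<phi>] C2_torus_uminus(2)[OF \<phi>])
qed

lemma subsolution_uminus:
  assumes "viscosity_subsolution \<nu> j (\<lambda>x p. - H x (- p)) (- c) l (\<lambda>x. - u x)"
  shows "viscosity_supersolution \<nu> j H c l u"
  unfolding viscosity_supersolution_def
proof (intro conjI ballI allI impI)
  have "(\<lambda>x. - u x) \<in> C0_torus" using assms by (simp add: viscosity_subsolution_def)
  from C0_torus_uminus[OF this] show "u \<in> C0_torus" by simp
  fix \<phi> :: "real ^ 'n \<Rightarrow> real" and x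
  assume \<phi>: "\<phi> \<in> C2_torus" and min: "\<forall>y. u x - \<phi> x \<le> u y - \<phi> y"
  have "l * - u x - nonlocal_op \<nu> j (\<lambda>x. - \<phi> x) x + - H x (- grad (\<lambda>x. - \<phi> x) x) \<le> - c"
    using assms min C2_torus_uminus(1)[OF \<phi>]
    unfolding viscosity_subsolution_def by (auto simp: algebra_simps)
  then show "c \<le> l * u x - nonlocal_op \<nu> j \<phi> x + H x (grad \<phi> x)"
    by (simp add: nonlocal_op_uminus[OF \<phi>] C2_torus_uminus(2)[OF \<phi>])
qed

text \<open>The test function is used only where it is needed for integrability, near the
  singularity of the measure; beyond \<open>\<delta>\<close> the function itself appears, as
  comparison requires.\<close>

definition incr_split ::
  "real \<Rightarrow> (real ^ 'n \<Rightarrow> real) \<Rightarrow> (real ^ 'n \<Rightarrow> real) \<Rightarrow> real ^ 'n \<Rightarrow> real ^ 'n \<Rightarrow> real ^ 'n \<Rightarrow> real" where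
  "incr_split \<delta> \<phi> f q x z = (if norm z < \<delta> then incr \<phi> q x z else incr f q x z)"

lemma incr_split_integrable:
  assumes \<phi>: "\<phi> \<in> C2_torus" and u: "u \<in> C0_torus" and \<delta>: "0 < \<delta>" "\<delta> \<le> 1"
  shows "integrable \<nu> (incr_split \<delta> \<phi> u (grad \<phi> x) x)"
proof -
  obtain C where C: "C > 0" "\<And>x z. \<bar>incr \<phi> (grad \<phi> x) x z\<bar> \<le> C * levy_weight z"
    by (rule incr_C2_bound[OF \<phi>]) (rule that; blast)
  have per: "periodic u" and cont: "continuous_on UNIV u" using u by (auto simp: C0_torus_def)
  obtain B where B: "B > 0" "\<And>x. norm (u x) \<le> B" using periodic_bounded[OF per cont] by blast
  let ?q = "grad \<phi> x"
  \<comment> \<open>Beyond \<open>\<delta>\<close> the integrand is bounded by 2 B + Cj |q|, and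
    there \<open>levy_weight\<close> is at least \<open>\<delta>^2\<close>.\<close>
  define K where "K = (2 * B + Cj * norm ?q) / \<delta>\<^sup>2"
  have "K \<ge> 0" using B Cj_pos by (simp add: K_def)
  have out: "\<bar>incr u ?q x z\<bar> \<le> K * levy_weight z" if z: "\<delta> \<le> norm z" for z
  proof -
    have "\<bar>indicator (ball 0 1) z * (j x z \<bullet> ?q)\<bar> \<le> Cj * norm ?q"
    proof (cases "norm z < 1")
      case True
      have "\<bar>j x z \<bullet> ?q\<bar> \<le> norm (j x z) * norm ?q" by (rule Cauchy_Schwarz_ineq2)
      also have "\<dots> \<le> Cj * norm ?q"
      proof (rule mult_right_mono)
        have "norm (j x z) \<le> Cj * norm z" by (rule j_bound)
        also have "\<dots> \<le> Cj" using True Cj_pos by simp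
        finally show "norm (j x z) \<le> Cj" .
      qed simp
      finally show ?thesis using True by simp
    qed (use Cj_pos in simp)
    then have "\<bar>incr u ?q x z\<bar> \<le> 2 * B + Cj * norm ?q"
      using B(2)[of x] B(2)[of "x + j x z"] unfolding incr_def real_norm_def by linarith
    also have "\<dots> \<le> (2 * B + Cj * norm ?q) * (levy_weight z / \<delta>\<^sup>2)"
      using levy_weight_outside[OF z \<delta>] B(1) Cj_pos
      by (metis mult_left_mono mult.right_neutral add_nonneg_nonneg less_imp_le mult_nonneg_nonneg
          norm_ge_zero zero_le_numeral)
    finally show ?thesis by (simp add: K_def)
  qed
  show ?thesis
  proof (rule integrable_by_weight)
    have "{z \<in> space \<nu>. norm z < \<delta>} = ball 0 \<delta>"
      using sets_eq_imp_space_eq[OF sets_nu] by auto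
    then have "{z \<in> space \<nu>. norm z < \<delta>} \<in> sets \<nu>" by (simp add: sets_nu)
    then show "incr_split \<delta> \<phi> u ?q x \<in> borel_measurable \<nu>"
      unfolding incr_split_def
      by (intro measurable_If incr_measurable[OF C2_torus_continuous(1)[OF \<phi>]] incr_measurable[OF cont])
    show "\<bar>incr_split \<delta> \<phi> u ?q x z\<bar> \<le> (C + K) * levy_weight z" for z
    proof -
      have "0 \<le> K * levy_weight z" "0 \<le> C * levy_weight z"
        using \<open>K \<ge> 0\<close> C(1) levy_weight_nonneg[of z] by auto
      then show ?thesis
        using C(2)[of x z] out[of z] unfolding incr_split_def distrib_right by (cases "norm z < \<delta>") auto
    qed
  qed
qed

text \<open>Squeeze test functions between \<open>u\<close> and \<open>\<phi>\<close> and let them decrease to \<open>u\<close>.\<close>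

lemma subsolution_split:
  assumes sub: "viscosity_subsolution \<nu> j H c l u" and lip: "\<kappa>-lipschitz_on UNIV u"
    and \<phi>: "\<phi> \<in> C2_torus" and max: "\<And>y. u y - \<phi> y \<le> u x - \<phi> x"
    and \<delta>: "0 < \<delta>" "\<delta> \<le> 1"
  shows "l * u x - (\<integral>z. incr_split \<delta> \<phi> u (grad \<phi> x) x z \<partial>\<nu>) + H x (grad \<phi> x) \<le> c"
proof -
  have u: "u \<in> C0_torus" using sub by (simp add: viscosity_subsolution_def)
  then have per: "periodic u" by (simp add: C0_torus_def)
  \<comment> \<open>\<open>\<phi>\<close> shifted by a constant so that it touches \<open>u\<close>
    from above at \<open>x\<close>.\<close>
  define g where "g y = 1 * \<phi> y + 1 * (u x - \<phi> x)" for y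
  have g: "g \<in> C2_torus" unfolding g_def by (intro C2_torus_lincomb \<phi> C2_torus_const)
  have ug: "u y \<le> g y" for y using max[of y] by (simp add: g_def)
  have gx: "g x = u x" by (simp add: g_def)
  have gg: "grad g x = grad \<phi> x"
    unfolding g_def using C2_torus_lincomb(2)[OF \<phi> C2_torus_const, of 1 1 "u x - \<phi> x"]
      grad_eqI[OF GDERIV_const] by auto
  let ?q = "grad \<phi> x"
  define A where "A = l * u x - (\<integral>z. incr_split \<delta> \<phi> u ?q x z \<partial>\<nu>) + H x ?q"
  have "A \<le> c + s * ((\<integral>z. levy_weight z \<partial>\<nu>) / \<delta>\<^sup>2)" if s: "s > 0" for s
  proof -
    obtain \<psi> where \<psi>: "\<psi> \<in> C2_torus" "\<And>y. u y \<le> \<psi> y" "\<And>y. \<psi> y \<le> g y" "\<And>y. \<psi> y \<le> u y + s"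
      using C2_torus_approx_from_above[OF per lip g ug s] by blast
    have \<psi>x: "\<psi> x = u x" using \<psi>(2)[of x] \<psi>(3)[of x] gx by simp
    have gp: "grad \<psi> x = ?q"
      using GDERIV_touching[OF C2_torus_GDERIV[OF \<psi>(1)] C2_torus_GDERIV[OF g] \<psi>(3)] \<psi>x gx gg by simp
    \<comment> \<open>Below \<open>\<delta>\<close> the squeeze under \<open>g\<close> is used,
      beyond it closeness to \<open>u\<close>. The latter costs \<open>s\<close> per jump, paid for
      by \<open>levy_weight / \<delta>^2\<close> >= 1, so the total error is linear in
      \<open>s\<close> at fixed \<open>\<delta>\<close>.\<close>
    have le: "incr \<psi> ?q x z \<le> incr_split \<delta> \<phi> u ?q x z + s / \<delta>\<^sup>2 * levy_weight z" for z
    proof (cases "norm z < \<delta>")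
      case True
      have "0 \<le> s / \<delta>\<^sup>2 * levy_weight z" using s levy_weight_nonneg[of z] by simp
      then show ?thesis
        using True \<psi>(3)[of "x + j x z"] \<psi>x by (simp add: incr_split_def incr_def g_def)
    next
      case False
      then have "s * 1 \<le> s * (levy_weight z / \<delta>\<^sup>2)"
        using s \<delta> by (intro mult_left_mono levy_weight_outside) auto
      then show ?thesis
        using False \<psi>(4)[of "x + j x z"] \<psi>x by (simp add: incr_split_def incr_def)
    qed
    have "nonlocal_op \<nu> j \<psi> x = (\<integral>z. incr \<psi> ?q x z \<partial>\<nu>)" by (simp add: nonlocal_op_eq gp)
    also have "\<dots> \<le> (\<integral>z. incr_split \<delta> \<phi> u ?q x z + s / \<delta>\<^sup>2 * levy_weight z \<partial>\<nu>)"
      using incr_C2_integrable[OF \<psi>(1), of x] incr_split_integrable[OF \<phi> u \<delta>, of x] levy_weight_integrable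
      by (intro integral_mono le) (auto simp: gp)
    also have "\<dots> = (\<integral>z. incr_split \<delta> \<phi> u ?q x z \<partial>\<nu>) + s * ((\<integral>z. levy_weight z \<partial>\<nu>) / \<delta>\<^sup>2)"
      using incr_split_integrable[OF \<phi> u \<delta>, of x] levy_weight_integrable by simp
    finally have "nonlocal_op \<nu> j \<psi> x
        \<le> (\<integral>z. incr_split \<delta> \<phi> u ?q x z \<partial>\<nu>) + s * ((\<integral>z. levy_weight z \<partial>\<nu>) / \<delta>\<^sup>2)" .
    moreover have "l * u x - nonlocal_op \<nu> j \<psi> x + H x ?q \<le> c"
      using sub \<psi>(1,2) \<psi>x gp unfolding viscosity_subsolution_def by (metis diff_self diff_le_0_iff_le)
    ultimately show ?thesis unfolding A_def by linarith
  qed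
  then show ?thesis unfolding A_def[symmetric] by (rule le_if_le_add_mult_eps)
qed

lemma supersolution_split:
  assumes sup: "viscosity_supersolution \<nu> j H c l u" and lip: "\<kappa>-lipschitz_on UNIV u"
    and \<phi>: "\<phi> \<in> C2_torus" and min: "\<And>y. u x - \<phi> x \<le> u y - \<phi> y"
    and \<delta>: "0 < \<delta>" "\<delta> \<le> 1"
  shows "c \<le> l * u x - (\<integral>z. incr_split \<delta> \<phi> u (grad \<phi> x) x z \<partial>\<nu>) + H x (grad \<phi> x)"
proof -
  have lip': "\<kappa>-lipschitz_on UNIV (\<lambda>x. - u x)" using lip by (rule lipschitz_on_minus)
  have "incr_split \<delta> (\<lambda>x. - \<phi> x) (\<lambda>x. - u x) (- q) x z = - incr_split \<delta> \<phi> u q x z" for q z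
    by (simp add: incr_split_def incr_uminus)
  then show ?thesis
    using subsolution_split[OF supersolution_uminus[OF sup] lip' C2_torus_uminus(1)[OF \<phi>] _ \<delta>, of x] min
    by (auto simp: C2_torus_uminus(2)[OF \<phi>] algebra_simps)
qed

text \<open>The maximum of \<open>v - \<phi>\<close> may not be strict. Adding \<open>e\<close>
  times the periodic penalty makes it strict modulo the lattice without changing the gradient at
  \<open>x\<close>; maximum points of the perturbed problems then converge, and the linear
  dependence on \<open>e\<close> lets it tend to 0 at the end.\<close>

lemma subsolution_uniform_limit:
  fixes u :: "nat \<Rightarrow> real ^ 'n \<Rightarrow> real"
  assumes sub: "\<And>k. viscosity_subsolution \<nu> j H c (L k) (u k)" and L: "L \<longlonglongrightarrow> l"
    and lim: "uniform_limit UNIV u v sequentially"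
    and H: "continuous_on UNIV (\<lambda>(x, p). H x p)"
  shows "viscosity_subsolution \<nu> j H c l v"
  unfolding viscosity_subsolution_def
proof (intro conjI ballI allI impI)
  have u0: "u k \<in> C0_torus" for k using sub by (simp add: viscosity_subsolution_def)
  have pt: "(\<lambda>k. u k x) \<longlonglongrightarrow> v x" for x using tendsto_uniform_limitI[OF lim] by simp
  have "continuous_on UNIV v"
    by (rule uniform_limit_theorem[OF _ lim]) (use u0 in \<open>auto simp: C0_torus_def\<close>)
  moreover have "periodic v"
    unfolding periodic_def
  proof (intro allI impI)
    fix x k :: "real ^ 'n" assume k: "\<forall>i. k $ i \<in> \<int>"
    have "(\<lambda>m. u m (x + k)) = (\<lambda>m. u m x)"
      using u0 k by (auto simp: C0_torus_def intro: periodicD)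
    then show "v (x + k) = v x" using pt[of x] pt[of "x + k"] LIMSEQ_unique by metis
  qed
  ultimately show v: "v \<in> C0_torus" by (simp add: C0_torus_def)
  fix \<phi> :: "real ^ 'n \<Rightarrow> real" and x
  assume \<phi>: "\<phi> \<in> C2_torus" and max: "\<forall>y. v y - \<phi> y \<le> v x - \<phi> x"
  let ?p = "\<lambda>y. trig_gap (y - x)"
  have "l * v x - nonlocal_op \<nu> j \<phi> x + H x (grad \<phi> x) \<le> c + e * nonlocal_op \<nu> j ?p x" if e: "e > 0" for e
  proof -
    define g where "g y = 1 * \<phi> y + e * ?p y" for y
    have g: "g \<in> C2_torus" unfolding g_def by (intro C2_torus_lincomb \<phi> C2_torus_trig_gap)
    have Ig: "nonlocal_op \<nu> j g x = nonlocal_op \<nu> j \<phi> x + e * nonlocal_op \<nu> j ?p x"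
      unfolding g_def by (subst nonlocal_op_lincomb[OF \<phi> C2_torus_trig_gap]) simp
    have gx: "grad g x = grad \<phi> x"
      unfolding g_def by (subst C2_torus_lincomb(2)[OF \<phi> C2_torus_trig_gap])
        (simp add: grad_trig_gap trig_gap_grad_def vec_eq_iff)
    \<comment> \<open>Strictness holds only modulo integer vectors, so the maximizer is translated
      into the cell around \<open>x\<close>; otherwise it need not converge.\<close>
    have "\<exists>y. y - x \<in> unit_cell \<and> (\<forall>y'. u k y' - g y' \<le> u k y - g y)" for k
    proof -
      have d: "(\<lambda>y. u k y - g y) \<in> C0_torus" by (intro C0_torus_diff u0 C2_torus_C0 g)
      obtain y where y: "\<And>y'. u k y' - g y' \<le> u k y - g y"
        using C0_torus_attains_max[OF d] by blast
      obtain m where m: "\<And>i. m $ i \<in> \<int>" "y - x + m \<in> unit_cell" using shift_into_unit_cell by blast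
      have "u k (y + m) - g (y + m) = u k y - g y"
        using periodicD[of "\<lambda>y. u k y - g y" m y] d m(1) by (simp add: C0_torus_def)
      then show ?thesis using y m(2) by (intro exI[of _ "y + m"]) (simp add: add.commute add_diff_eq)
    qed
    then obtain X where X: "\<And>k. X k - x \<in> unit_cell" "\<And>k y. u k y - g y \<le> u k (X k) - g (X k)"
      by metis
    have Xlim: "X \<longlonglongrightarrow> x"
    proof (rule LIMSEQ_I)
      fix r :: real assume r: "r > 0"
      \<comment> \<open>Maximality for \<open>u k\<close> and for \<open>v\<close> gives
        \<open>e * ?p (X k)\<close> < 2 t, while the quadratic lower bound of the penalty is 8 e |X
        k - x|^2; hence t = 4 e r^2.\<close>
      define t where "t = 4 * e * r\<^sup>2"
      have "t > 0" using e r by (simp add: t_def)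
      then have "\<exists>N. \<forall>k\<ge>N. \<forall>y. \<bar>u k y - v y\<bar> < t"
        using lim unfolding uniform_limit_sequentially_iff dist_real_def by simp
      then obtain N where N: "\<And>k y. k \<ge> N \<Longrightarrow> \<bar>u k y - v y\<bar> < t" by blast
      show "\<exists>N. \<forall>k\<ge>N. norm (X k - x) < r"
      proof (intro exI allI impI)
        fix k assume k: "N \<le> k"
        have "e * ?p (X k) < 2 * t"
          using X(2)[of k x] max[rule_format, of "X k"] N[OF k, of x] N[OF k, of "X k"]
          by (simp add: g_def)
        moreover have "e * (8 * (norm (X k - x))\<^sup>2) \<le> e * ?p (X k)"
          using e by (intro mult_left_mono trig_gap_lower X(1)) auto
        ultimately have "e * (8 * (norm (X k - x))\<^sup>2) < e * (8 * r\<^sup>2)" by (simp add: t_def)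
        then have "(norm (X k - x))\<^sup>2 < r\<^sup>2" using e by simp
        then show "norm (X k - x) < r" using r by (meson less_imp_le power2_less_imp_less)
      qed
    qed
    have cont: "continuous_on UNIV (grad g)" using C2_torus_continuous(2)[OF g] .
    have "(\<lambda>k. u k (X k) - v (X k)) \<longlonglongrightarrow> 0"
    proof (rule LIMSEQ_I)
      fix r :: real assume "r > 0"
      then have "\<exists>N. \<forall>k\<ge>N. \<forall>y. \<bar>u k y - v y\<bar> < r"
        using lim unfolding uniform_limit_sequentially_iff dist_real_def by simp
      then show "\<exists>N. \<forall>k\<ge>N. norm (u k (X k) - v (X k) - 0) < r" by auto
    qed
    moreover have "(\<lambda>k. v (X k)) \<longlonglongrightarrow> v x"
      using v by (intro continuous_on_tendsto_compose[OF _ Xlim]) (auto simp: C0_torus_def)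
    ultimately have ulim: "(\<lambda>k. u k (X k)) \<longlonglongrightarrow> v x" using tendsto_add by force
    have "(\<lambda>k. (X k, grad g (X k))) \<longlonglongrightarrow> (x, grad g x)"
      by (intro tendsto_Pair Xlim continuous_on_tendsto_compose[OF cont Xlim]) auto
    then have Hlim: "(\<lambda>k. H (X k) (grad g (X k))) \<longlonglongrightarrow> H x (grad g x)"
      using continuous_on_tendsto_compose[OF H] by fastforce
    have "(\<lambda>k. L k * u k (X k) - nonlocal_op \<nu> j g (X k) + H (X k) (grad g (X k)))
        \<longlonglongrightarrow> l * v x - nonlocal_op \<nu> j g x + H x (grad g x)"
      by (intro tendsto_intros L ulim Hlim tendsto_nonlocal_op g Xlim)
    moreover have "L k * u k (X k) - nonlocal_op \<nu> j g (X k) + H (X k) (grad g (X k)) \<le> c" for k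
      using sub[of k] g X(2)[of k] unfolding viscosity_subsolution_def by blast
    ultimately have "l * v x - nonlocal_op \<nu> j g x + H x (grad g x) \<le> c"
      using LIMSEQ_le_const2 by blast
    then show ?thesis unfolding Ig gx by linarith
  qed
  then show "l * v x - nonlocal_op \<nu> j \<phi> x + H x (grad \<phi> x) \<le> c" by (rule le_if_le_add_mult_eps)
qed

lemma solution_uniform_limit:
  fixes u :: "nat \<Rightarrow> real ^ 'n \<Rightarrow> real"
  assumes sol: "\<And>k. viscosity_solution \<nu> j H c (L k) (u k)" and L: "L \<longlonglongrightarrow> l"
    and lim: "uniform_limit UNIV u v sequentially"
    and H: "continuous_on UNIV (\<lambda>(x, p). H x p)"
  shows "viscosity_solution \<nu> j H c l v"
  unfolding viscosity_solution_def
proof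
  show "viscosity_subsolution \<nu> j H c l v"
    by (rule subsolution_uniform_limit[OF _ L lim H]) (use sol in \<open>simp add: viscosity_solution_def\<close>)
  have "continuous_on UNIV (\<lambda>y. (\<lambda>(x, p). H x p) (fst y, - snd y))"
    by (intro continuous_on_compose2[OF H] continuous_intros) auto
  then have H': "continuous_on UNIV (\<lambda>(x, p). - H x (- p))"
    using continuous_on_minus by (fastforce simp: case_prod_unfold)
  have "viscosity_subsolution \<nu> j (\<lambda>x p. - H x (- p)) (- c) l (\<lambda>x. - v x)"
    by (rule subsolution_uniform_limit[OF supersolution_uminus L uniform_limit_uminus[OF lim] H'])
      (use sol in \<open>simp add: viscosity_solution_def\<close>)
  then show "viscosity_supersolution \<nu> j H c l v" by (rule subsolution_uminus)
qed

end

section \<open>Comparison by tripling the variables\<close>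

lemma C2_torus_scale:
  assumes "\<phi> \<in> C2_torus"
  shows "(\<lambda>x. a * \<phi> x) \<in> C2_torus" and "grad (\<lambda>x. a * \<phi> x) x = a *\<^sub>R grad \<phi> x"
  using C2_torus_lincomb[OF assms assms, of a 0] by simp_all

lemma lipschitz_real_le:
  fixes u :: "'a::real_normed_vector \<Rightarrow> real"
  assumes "\<kappa>-lipschitz_on UNIV u"
  shows "u x - u y \<le> \<kappa> * norm (x - y)"
  using lipschitz_onD[OF assms, of x y] by (simp add: dist_norm)

lemma trig_gap_taylor:
  obtains P where "P > 0"
    "\<And>h k :: real ^ 'n::finite. \<bar>trig_gap (h + k) - trig_gap h - k \<bullet> trig_gap_grad h\<bar> \<le> P * (norm k)\<^sup>2"
proof -
  have C2: "(\<lambda>x :: real ^ 'n. trig_gap (x - 0)) \<in> C2_torus" by (rule C2_torus_trig_gap)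
  obtain P where P: "P > 0"
    "\<And>h k :: real ^ 'n. \<bar>trig_gap (h + k - 0) - trig_gap (h - 0) - k \<bullet> grad (\<lambda>x. trig_gap (x - 0)) h\<bar> \<le> P * (norm k)\<^sup>2"
    by (rule C2_torus_taylor[OF C2]) (rule that; blast)
  then show thesis using that[of P] by (simp add: grad_trig_gap[of 0, simplified])
qed

text \<open>With the other variables frozen, dividing by \<open>a\<close> or \<open>b\<close> leaves
  the test function \<open>trig_gap / \<epsilon>\<close> for each subsolution. In \<open>z\<close>
  the weights survive, which yields the combined gradient at the supersolution.\<close>

definition coupling_penalty ::
  "real \<Rightarrow> real \<Rightarrow> real \<Rightarrow> real ^ 'n::finite \<Rightarrow> real ^ 'n \<Rightarrow> real ^ 'n \<Rightarrow> real" where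
  "coupling_penalty \<epsilon> a b x y z = (a * trig_gap (x - z) + b * trig_gap (y - z)) / \<epsilon>"

lemma coupling_penalty_nonneg:
  "\<epsilon> \<ge> 0 \<Longrightarrow> a \<ge> 0 \<Longrightarrow> b \<ge> 0 \<Longrightarrow> 0 \<le> coupling_penalty \<epsilon> a b x y z"
  unfolding coupling_penalty_def
  by (intro divide_nonneg_nonneg add_nonneg_nonneg mult_nonneg_nonneg trig_gap_nonneg)

text \<open>In the variables h = x - z, k = y - z, z the functional is periodic separately in each,
  so a maximum over a product of three cells is global. These coordinates also place both
  differences in the cell, where the quadratic lower bound of the penalty is valid.\<close>

lemma penalized_max_exists:
  fixes u1 u2 v :: "real ^ 'n::finite \<Rightarrow> real"
  assumes u: "u1 \<in> C0_torus" "u2 \<in> C0_torus" "v \<in> C0_torus"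
  obtains x y z where "x - z \<in> unit_cell" "y - z \<in> unit_cell" "z \<in> unit_cell"
    "\<And>x' y' z'. a * u1 x' + b * u2 y' - v z' - coupling_penalty \<epsilon> a b x' y' z'
      \<le> a * u1 x + b * u2 y - v z - coupling_penalty \<epsilon> a b x y z"
proof -
  define F where "F h k z = a * u1 (z + h) + b * u2 (z + k) - v z - (a * trig_gap h + b * trig_gap k) / \<epsilon>"
    for h k z :: "real ^ 'n"
  have cont: "continuous_on UNIV u1" "continuous_on UNIV u2" "continuous_on UNIV v"
    "continuous_on UNIV (trig_gap :: real ^ 'n \<Rightarrow> real)"
    using u C2_torus_continuous(1)[OF C2_torus_trig_gap[of 0]] by (auto simp: C0_torus_def)
  let ?S = "unit_cell \<times> unit_cell \<times> unit_cell :: ((real ^ 'n) \<times> (real ^ 'n) \<times> (real ^ 'n)) set"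
  have "continuous_on ?S (\<lambda>(h, k, z). F h k z)"
    unfolding F_def case_prod_unfold divide_inverse
    by (intro continuous_intros continuous_on_compose2[OF cont(1)] continuous_on_compose2[OF cont(2)]
        continuous_on_compose2[OF cont(3)] continuous_on_compose2[OF cont(4)]) auto
  moreover have "compact ?S" by (intro compact_Times compact_unit_cell)
  moreover have "?S \<noteq> {}" by (metis SigmaI empty_iff shift_into_unit_cell)
  ultimately have "\<exists>p\<in>?S. \<forall>q\<in>?S. (\<lambda>(h, k, z). F h k z) q \<le> (\<lambda>(h, k, z). F h k z) p"
    by (intro continuous_attains_sup)
  then obtain p where p: "p \<in> ?S" "\<forall>q\<in>?S. (\<lambda>(h, k, z). F h k z) q \<le> (\<lambda>(h, k, z). F h k z) p" ..
  obtain h k z where hkz: "p = (h, k, z)" by (cases p)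
  have max: "F h' k' z' \<le> F h k z" if "h' \<in> unit_cell" "k' \<in> unit_cell" "z' \<in> unit_cell" for h' k' z'
    using p(2) that by (auto simp: hkz)
  have shift_z: "F h' k' (z' + m) = F h' k' z'" if m: "\<And>i. m $ i \<in> \<int>" for h' k' z' m
  proof -
    have "u1 (z' + h' + m) = u1 (z' + h')" "u2 (z' + k' + m) = u2 (z' + k')" "v (z' + m) = v z'"
      using u m by (auto simp: C0_torus_def intro: periodicD)
    then show ?thesis unfolding F_def by (simp add: ac_simps)
  qed
  have shift_h: "F (h' + m) k' z' = F h' k' z'" if m: "\<And>i. m $ i \<in> \<int>" for h' k' z' m
  proof -
    have "u1 (z' + h' + m) = u1 (z' + h')" "trig_gap (h' + m) = trig_gap h'"
      using u m periodic_trig_gap by (auto simp: C0_torus_def intro: periodicD)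
    then show ?thesis unfolding F_def by (simp add: ac_simps)
  qed
  have shift_k: "F h' (k' + m) z' = F h' k' z'" if m: "\<And>i. m $ i \<in> \<int>" for h' k' z' m
  proof -
    have "u2 (z' + k' + m) = u2 (z' + k')" "trig_gap (k' + m) = trig_gap k'"
      using u m periodic_trig_gap by (auto simp: C0_torus_def intro: periodicD)
    then show ?thesis unfolding F_def by (simp add: ac_simps)
  qed
  have glob: "F h' k' z' \<le> F h k z" for h' k' z'
  proof -
    obtain m1 where m1: "\<And>i. m1 $ i \<in> \<int>" "h' + m1 \<in> unit_cell" using shift_into_unit_cell by blast
    obtain m2 where m2: "\<And>i. m2 $ i \<in> \<int>" "k' + m2 \<in> unit_cell" using shift_into_unit_cell by blast
    obtain m3 where m3: "\<And>i. m3 $ i \<in> \<int>" "z' + m3 \<in> unit_cell" using shift_into_unit_cell by blast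
    have "F h' k' z' = F (h' + m1) (k' + m2) (z' + m3)"
      by (simp add: shift_h[OF m1(1)] shift_k[OF m2(1)] shift_z[OF m3(1)])
    also have "\<dots> \<le> F h k z" by (rule max[OF m1(2) m2(2) m3(2)])
    finally show ?thesis .
  qed
  show thesis
  proof (rule that[of "z + h" z "z + k"])
    show "z + h - z \<in> unit_cell" "z + k - z \<in> unit_cell" "z \<in> unit_cell" using p(1) by (auto simp: hkz)
    show "a * u1 x' + b * u2 y' - v z' - coupling_penalty \<epsilon> a b x' y' z'
      \<le> a * u1 (z + h) + b * u2 (z + k) - v z - coupling_penalty \<epsilon> a b (z + h) (z + k) z" for x' y' z'
      using glob[of "x' - z'" "y' - z'" z'] by (simp add: F_def coupling_penalty_def)
  qed
qed

context levy_jumps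
begin

section \<open>Jump-by-jump estimates at a penalized maximum\<close>

lemma incr_trig_gap_bound:
  assumes P: "\<And>h k :: real ^ 'n. \<bar>trig_gap (h + k) - trig_gap h - k \<bullet> trig_gap_grad h\<bar> \<le> P * (norm k)\<^sup>2"
    and "P > 0" "norm \<zeta> < 1"
  shows "\<bar>incr (\<lambda>x. trig_gap (x - y)) (trig_gap_grad (x - y)) x \<zeta>\<bar> \<le> P * Cj\<^sup>2 * (norm \<zeta>)\<^sup>2"
proof -
  have "\<bar>incr (\<lambda>x. trig_gap (x - y)) (trig_gap_grad (x - y)) x \<zeta>\<bar> \<le> P * (norm (j x \<zeta>))\<^sup>2"
    using P[of "x - y" "j x \<zeta>"] \<open>norm \<zeta> < 1\<close> by (simp add: incr_def algebra_simps)
  also have "\<dots> \<le> P * (Cj\<^sup>2 * (norm \<zeta>)\<^sup>2)" using \<open>P > 0\<close> by (intro mult_left_mono j_power2_bound) auto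
  finally show ?thesis by (simp add: mult.assoc)
qed

definition tail_gap :: "real ^ 'n \<Rightarrow> real ^ 'n \<Rightarrow> real ^ 'n \<Rightarrow> real" where
  "tail_gap x y \<zeta> = indicator (UNIV - ball 0 1) \<zeta> * norm (j x \<zeta> - j y \<zeta>)"

lemma tail_gap_integral:
  shows "integrable \<nu> (tail_gap x y)" and "(\<integral>\<zeta>. tail_gap x y \<zeta> \<partial>\<nu>) \<le> Ct * norm (x - y)"
proof -
  have nonneg: "0 \<le> tail_gap x y \<zeta>" for \<zeta> by (simp add: tail_gap_def)
  have "(\<lambda>z. j x z - j y z) \<in> borel_measurable borel"
    by (intro borel_measurable_diff j_measurable)
  then have [measurable]: "(\<lambda>z. norm (j x z - j y z)) \<in> borel_measurable borel"
    using measurable_compose[OF _ borel_measurable_continuous_onI[OF continuous_on_norm_id]] by blast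
  have [measurable]: "ball 0 1 \<in> sets (borel :: (real ^ 'n) measure)" by (intro borel_open open_ball)
  have meas: "tail_gap x y \<in> borel_measurable \<nu>"
    by (rule measurable_nu) (unfold tail_gap_def, measurable)
  have eq: "(\<integral>\<^sup>+\<zeta>. ennreal (tail_gap x y \<zeta>) \<partial>\<nu>)
      = (\<integral>\<^sup>+z\<in>UNIV - ball 0 1. ennreal (norm (j x z - j y z)) \<partial>\<nu>)"
    by (rule nn_integral_cong) (auto simp: tail_gap_def indicator_def)
  then have le: "(\<integral>\<^sup>+\<zeta>. ennreal (tail_gap x y \<zeta>) \<partial>\<nu>) \<le> ennreal (Ct * norm (x - y))"
    using j_tail by simp
  show int: "integrable \<nu> (tail_gap x y)"
    using le nonneg meas by (intro integrableI_bounded) (auto intro: le_less_trans)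
  show "(\<integral>\<zeta>. tail_gap x y \<zeta> \<partial>\<nu>) \<le> Ct * norm (x - y)"
    using le nn_integral_eq_integral[OF int] nonneg Ct_pos by simp
qed

definition small_jumps :: "real \<Rightarrow> real ^ 'n \<Rightarrow> real" where
  "small_jumps \<delta> \<zeta> = indicator (ball 0 \<delta>) \<zeta> * (norm \<zeta>)\<^sup>2"

lemma small_jumps_measurable: "small_jumps \<delta> \<in> borel_measurable \<nu>"
proof -
  have [measurable]: "ball 0 \<delta> \<in> sets (borel :: (real ^ 'n) measure)" by (intro borel_open open_ball)
  show ?thesis unfolding small_jumps_def by (intro measurable_nu) measurable
qed

lemma small_jumps_le_weight: "\<delta> \<le> 1 \<Longrightarrow> \<bar>small_jumps \<delta> \<zeta>\<bar> \<le> 1 * levy_weight \<zeta>"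
  using levy_weight_inside[of \<zeta>] levy_weight_nonneg[of \<zeta>] by (auto simp: small_jumps_def indicator_def)

lemma small_jumps_integrable: "\<delta> \<le> 1 \<Longrightarrow> integrable \<nu> (small_jumps \<delta>)"
  by (rule integrable_by_weight[OF small_jumps_measurable small_jumps_le_weight])

lemma small_jumps_tendsto_0: "(\<lambda>k. \<integral>\<zeta>. small_jumps (1 / real (Suc k)) \<zeta> \<partial>\<nu>) \<longlonglongrightarrow> 0"
proof -
  have lim: "(\<lambda>k. small_jumps (1 / real (Suc k)) \<zeta>) \<longlonglongrightarrow> 0" for \<zeta> :: "real ^ 'n"
  \<comment> \<open>The origin belongs to every ball, but the integrand vanishes there, so a
    possible atom contributes nothing.\<close>
  proof (cases "\<zeta> = 0")
    case False
    have "(\<lambda>k. 1 / real (Suc k)) \<longlonglongrightarrow> 0" using LIMSEQ_Suc[OF lim_const_over_n[of 1]] by simp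
    then have "\<forall>\<^sub>F k in sequentially. 1 / real (Suc k) < norm \<zeta>"
      using False order_tendstoD(2) zero_less_norm_iff by blast
    then have "\<forall>\<^sub>F k in sequentially. small_jumps (1 / real (Suc k)) \<zeta> = 0"
      by eventually_elim (simp add: small_jumps_def)
    then show ?thesis by (rule tendsto_eventually)
  qed (simp add: small_jumps_def)
  have "(\<lambda>k. \<integral>\<zeta>. small_jumps (1 / real (Suc k)) \<zeta> \<partial>\<nu>) \<longlonglongrightarrow> (\<integral>\<zeta>. 0 \<partial>\<nu>)"
  proof (rule integral_dominated_convergence[where w = levy_weight])
    show "AE \<zeta> in \<nu>. norm (small_jumps (1 / real (Suc k)) \<zeta>) \<le> levy_weight \<zeta>" for k
      using small_jumps_le_weight[of "1 / real (Suc k)"] by simp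
  qed (use lim small_jumps_measurable levy_weight_integrable in auto)
  then show ?thesis by simp
qed

text \<open>Each of the three terms on the right pays for a regime: |\<zeta>| <
  \<open>\<delta>\<close>, \<open>\<delta>\<close> <= |\<zeta>| < 1, and |\<zeta>| >= 1, where part
  of the weight term is used as well. All three are nonnegative, so in each regime the others may be
  discarded.\<close>

lemma penalized_integrand_bound:
  fixes a b \<epsilon> r P \<kappa> :: real
  assumes ab: "a > 0" "b > 0" "a + b = 1" and \<epsilon>: "\<epsilon> > 0" and \<delta>: "0 < \<delta>" "\<delta> \<le> 1"
    and lip: "\<kappa>-lipschitz_on UNIV u1" "\<kappa>-lipschitz_on UNIV u2"
    and P: "P > 0" "\<And>h k :: real ^ 'n. \<bar>trig_gap (h + k) - trig_gap h - k \<bullet> trig_gap_grad h\<bar> \<le> P * (norm k)\<^sup>2"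
    and max: "\<And>x' y' z'. a * u1 x' + b * u2 y' - v z' - coupling_penalty \<epsilon> a b x' y' z'
      \<le> a * u1 x + b * u2 y - v z - coupling_penalty \<epsilon> a b x y z"
    and r: "norm (x - z) \<le> r" "norm (y - z) \<le> r"
  defines "q1 \<equiv> (1 / \<epsilon>) *\<^sub>R trig_gap_grad (x - z)" and "q2 \<equiv> (1 / \<epsilon>) *\<^sub>R trig_gap_grad (y - z)"
    and "\<psi> \<equiv> \<lambda>z'. - (a / \<epsilon>) * trig_gap (z' - x) + - (b / \<epsilon>) * trig_gap (z' - y)"
  shows "a * incr_split \<delta> (\<lambda>x'. 1 / \<epsilon> * trig_gap (x' - z)) u1 q1 x \<zeta>
      + b * incr_split \<delta> (\<lambda>y'. 1 / \<epsilon> * trig_gap (y' - z)) u2 q2 y \<zeta>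
      - incr_split \<delta> \<psi> v (a *\<^sub>R q1 + b *\<^sub>R q2) z \<zeta>
    \<le> 2 * P * Cj\<^sup>2 / \<epsilon> * small_jumps \<delta> \<zeta> + (P * Cj\<^sup>2 * r\<^sup>2 / \<epsilon> + \<kappa> * r) * levy_weight \<zeta>
      + \<kappa> * (a * tail_gap x z \<zeta> + b * tail_gap y z \<zeta>)"
    (is "?L \<le> ?A + ?B + ?C")
proof -
  have \<kappa>: "\<kappa> \<ge> 0" using lip(1) by (rule lipschitz_on_nonneg)
  have r0: "0 \<le> r" using r(1) norm_ge_zero order_trans by blast
  have A0: "0 \<le> ?A" using P \<epsilon> by (simp add: small_jumps_def)
  have C0: "0 \<le> ?C" using \<kappa> ab by (simp add: tail_gap_def)
  have Brew: "?B = P * Cj\<^sup>2 * r\<^sup>2 / \<epsilon> * levy_weight \<zeta> + \<kappa> * r * levy_weight \<zeta>" by (simp add: distrib_right)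
  have B1: "0 \<le> P * Cj\<^sup>2 * r\<^sup>2 / \<epsilon> * levy_weight \<zeta>" and B2: "0 \<le> \<kappa> * r * levy_weight \<zeta>"
    using P(1) \<epsilon> \<kappa> r0 levy_weight_nonneg[of \<zeta>] by auto
  consider "norm \<zeta> < \<delta>" | "\<delta> \<le> norm \<zeta>" "norm \<zeta> < 1" | "1 \<le> norm \<zeta>" by linarith
  then show ?thesis
  proof cases
    \<comment> \<open>Only penalty increments occur. Each penalty term is seen twice, from its
      subsolution variable and from \<open>z\<close>, hence the factor 2.\<close>
    case 1
    then have n1: "norm \<zeta> < 1" using \<delta> by linarith
    let ?T = "\<lambda>x y. incr (\<lambda>x. trig_gap (x - y)) (trig_gap_grad (x - y)) x \<zeta>"
    have T: "\<bar>?T x y\<bar> \<le> P * Cj\<^sup>2 * (norm \<zeta>)\<^sup>2" for x y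
      by (rule incr_trig_gap_bound[OF P(2,1) n1])
    have q: "a *\<^sub>R q1 + b *\<^sub>R q2 = (- (a / \<epsilon>)) *\<^sub>R trig_gap_grad (z - x) + (- (b / \<epsilon>)) *\<^sub>R trig_gap_grad (z - y)"
      using trig_gap_grad_commute[of z x] trig_gap_grad_commute[of z y] by (simp add: q1_def q2_def)
    have e1: "incr (\<lambda>x'. 1 / \<epsilon> * trig_gap (x' - z)) q1 x \<zeta> = 1 / \<epsilon> * ?T x z"
      and e2: "incr (\<lambda>y'. 1 / \<epsilon> * trig_gap (y' - z)) q2 y \<zeta> = 1 / \<epsilon> * ?T y z"
      using incr_lincomb[of "1 / \<epsilon>" "\<lambda>x'. trig_gap (x' - z)" 0 "\<lambda>_. 0" _ 0] by (simp_all add: q1_def q2_def)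
    have e3: "incr \<psi> (a *\<^sub>R q1 + b *\<^sub>R q2) z \<zeta> = - (a / \<epsilon>) * ?T z x + - (b / \<epsilon>) * ?T z y"
      unfolding \<psi>_def q by (rule incr_lincomb)
    have "?L = a / \<epsilon> * (?T x z + ?T z x) + b / \<epsilon> * (?T y z + ?T z y)"
      using 1 unfolding incr_split_def e1 e2 e3 by (simp add: algebra_simps)
    also have "\<dots> \<le> a / \<epsilon> * (2 * (P * Cj\<^sup>2 * (norm \<zeta>)\<^sup>2)) + b / \<epsilon> * (2 * (P * Cj\<^sup>2 * (norm \<zeta>)\<^sup>2))"
      using T[of x z] T[of z x] T[of y z] T[of z y] ab \<epsilon>
      by (intro add_mono mult_left_mono) auto
    also have "\<dots> = (a + b) * (2 * P * Cj\<^sup>2 / \<epsilon> * (norm \<zeta>)\<^sup>2)"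
      using \<epsilon> by (simp add: field_simps)
    also have "\<dots> = ?A" using 1 ab by (simp add: small_jumps_def)
    finally show ?thesis using Brew B1 B2 C0 by linarith
  next
    case 2
    let ?k = "j x \<zeta> - j z \<zeta>" and ?m = "j y \<zeta> - j z \<zeta>"
    have kb: "(norm ?k)\<^sup>2 \<le> Cj\<^sup>2 * r\<^sup>2 * (norm \<zeta>)\<^sup>2" "(norm ?m)\<^sup>2 \<le> Cj\<^sup>2 * r\<^sup>2 * (norm \<zeta>)\<^sup>2"
    proof -
      have "norm (j w \<zeta> - j z \<zeta>) \<le> Cj * r * norm \<zeta>" if "norm (w - z) \<le> r" for w
        using j_lipschitz[of w \<zeta> z] that Cj_pos
        by (meson mult_left_mono mult_right_mono norm_ge_zero less_imp_le order_trans)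
      from power_mono[OF this norm_ge_zero, of _ 2] r
      show "(norm ?k)\<^sup>2 \<le> Cj\<^sup>2 * r\<^sup>2 * (norm \<zeta>)\<^sup>2" "(norm ?m)\<^sup>2 \<le> Cj\<^sup>2 * r\<^sup>2 * (norm \<zeta>)\<^sup>2"
        by (simp_all add: power_mult_distrib)
    qed
    \<comment> \<open>The compensators combine into the differences \<open>?k\<close>,
      \<open>?m\<close> of jumps, because the gradient at \<open>z\<close> is
      \<open>a *\<^sub>R q1 + b *\<^sub>R q2\<close>. After maximality is applied at the jumped
      points they are exactly the linear terms of the penalty; what remains is quadratic in
      differences of size \<open>Cj * r * norm \<zeta>\<close>.\<close>
    have "?L = (a * u1 (x + j x \<zeta>) + b * u2 (y + j y \<zeta>) - v (z + j z \<zeta>)) - (a * u1 x + b * u2 y - v z)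
        - (a * (?k \<bullet> q1) + b * (?m \<bullet> q2))"
      using 2 by (simp add: incr_split_def incr_def inner_diff_left inner_add_right algebra_simps)
    also have "\<dots> \<le> coupling_penalty \<epsilon> a b (x + j x \<zeta>) (y + j y \<zeta>) (z + j z \<zeta>)
        - coupling_penalty \<epsilon> a b x y z - (a * (?k \<bullet> q1) + b * (?m \<bullet> q2))"
      using max[of "x + j x \<zeta>" "y + j y \<zeta>" "z + j z \<zeta>"] by linarith
    also have "\<dots> = a / \<epsilon> * (trig_gap ((x - z) + ?k) - trig_gap (x - z) - ?k \<bullet> trig_gap_grad (x - z))
        + b / \<epsilon> * (trig_gap ((y - z) + ?m) - trig_gap (y - z) - ?m \<bullet> trig_gap_grad (y - z))"
    proof -
      have "x + j x \<zeta> - (z + j z \<zeta>) = (x - z) + ?k" "y + j y \<zeta> - (z + j z \<zeta>) = (y - z) + ?m" by simp_all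
      then show ?thesis
        unfolding coupling_penalty_def q1_def q2_def using \<epsilon> by (simp add: field_simps)
    qed
    also have "\<dots> \<le> a / \<epsilon> * (P * (Cj\<^sup>2 * r\<^sup>2 * (norm \<zeta>)\<^sup>2)) + b / \<epsilon> * (P * (Cj\<^sup>2 * r\<^sup>2 * (norm \<zeta>)\<^sup>2))"
    proof (intro add_mono mult_left_mono)
      show "trig_gap ((x - z) + ?k) - trig_gap (x - z) - ?k \<bullet> trig_gap_grad (x - z)
          \<le> P * (Cj\<^sup>2 * r\<^sup>2 * (norm \<zeta>)\<^sup>2)"
        using P(2)[of "x - z" ?k] mult_left_mono[OF kb(1) less_imp_le[OF P(1)]] by linarith
      show "trig_gap ((y - z) + ?m) - trig_gap (y - z) - ?m \<bullet> trig_gap_grad (y - z)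
          \<le> P * (Cj\<^sup>2 * r\<^sup>2 * (norm \<zeta>)\<^sup>2)"
        using P(2)[of "y - z" ?m] mult_left_mono[OF kb(2) less_imp_le[OF P(1)]] by linarith
    qed (use ab \<epsilon> in auto)
    also have "\<dots> = (a + b) * (P * Cj\<^sup>2 * r\<^sup>2 / \<epsilon> * (norm \<zeta>)\<^sup>2)"
      using \<epsilon> by (simp add: field_simps)
    also have "\<dots> = P * Cj\<^sup>2 * r\<^sup>2 / \<epsilon> * levy_weight \<zeta>"
      using 2 ab by (simp add: levy_weight_inside)
    finally show ?thesis using Brew A0 B2 C0 by linarith
  next
    \<comment> \<open>No compensator is left to cancel the linear terms of the penalty, so the
      maximum is compared with the diagonal point \<open>(?z, ?z, ?z)\<close>, where the penalty is
      0. Moving \<open>?x\<close> and \<open>?y\<close> to \<open>?z\<close> costs a Lipschitz term,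
      integrable by the tail hypothesis.\<close>
    case 3
    then have n: "\<not> norm \<zeta> < \<delta>" and w1: "levy_weight \<zeta> = 1" using \<delta> by (auto simp: levy_weight_def)
    let ?x = "x + j x \<zeta>" and ?y = "y + j y \<zeta>" and ?z = "z + j z \<zeta>"
    have L: "?L = (a * u1 ?x + b * u2 ?y - v ?z) - (a * u1 x + b * u2 y - v z)"
      using 3 n by (simp add: incr_split_def incr_def algebra_simps)
    have dx: "a * u1 ?x - a * u1 ?z \<le> a * (\<kappa> * (r + tail_gap x z \<zeta>))"
    proof -
      have "u1 ?x - u1 ?z \<le> \<kappa> * norm (?x - ?z)" by (rule lipschitz_real_le[OF lip(1)])
      also have "norm (?x - ?z) \<le> norm (x - z) + norm (j x \<zeta> - j z \<zeta>)"
        using norm_triangle_ineq[of "x - z" "j x \<zeta> - j z \<zeta>"] by (simp add: algebra_simps)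
      then have "\<kappa> * norm (?x - ?z) \<le> \<kappa> * (r + tail_gap x z \<zeta>)"
        using r(1) 3 \<kappa> by (intro mult_left_mono) (auto simp: tail_gap_def)
      finally have "a * (u1 ?x - u1 ?z) \<le> a * (\<kappa> * (r + tail_gap x z \<zeta>))"
        using ab by (intro mult_left_mono) auto
      then show ?thesis by (simp add: right_diff_distrib)
    qed
    have dy: "b * u2 ?y - b * u2 ?z \<le> b * (\<kappa> * (r + tail_gap y z \<zeta>))"
    proof -
      have "u2 ?y - u2 ?z \<le> \<kappa> * norm (?y - ?z)" by (rule lipschitz_real_le[OF lip(2)])
      also have "norm (?y - ?z) \<le> norm (y - z) + norm (j y \<zeta> - j z \<zeta>)"
        using norm_triangle_ineq[of "y - z" "j y \<zeta> - j z \<zeta>"] by (simp add: algebra_simps)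
      then have "\<kappa> * norm (?y - ?z) \<le> \<kappa> * (r + tail_gap y z \<zeta>)"
        using r(2) 3 \<kappa> by (intro mult_left_mono) (auto simp: tail_gap_def)
      finally have "b * (u2 ?y - u2 ?z) \<le> b * (\<kappa> * (r + tail_gap y z \<zeta>))"
        using ab by (intro mult_left_mono) auto
      then show ?thesis by (simp add: right_diff_distrib)
    qed
    have "0 \<le> coupling_penalty \<epsilon> a b x y z"
      by (rule coupling_penalty_nonneg) (use ab \<epsilon> in auto)
    then have "a * u1 ?z + b * u2 ?z - v ?z \<le> a * u1 x + b * u2 y - v z"
      using max[of ?z ?z ?z] by (simp add: coupling_penalty_def)
    then have "?L \<le> a * (\<kappa> * (r + tail_gap x z \<zeta>)) + b * (\<kappa> * (r + tail_gap y z \<zeta>))"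
      using L dx dy by linarith
    also have "\<dots> = (a + b) * (\<kappa> * r) + ?C" by (simp add: algebra_simps)
    also have "\<dots> = \<kappa> * r * levy_weight \<zeta> + ?C" using ab w1 by simp
    finally show ?thesis using Brew A0 B1 by linarith
  qed
qed

text \<open>The split viscosity inequalities in the three variables are added with weights
  \<open>a\<close>, \<open>b\<close>, -1; the constant \<open>c\<close> cancels because
  \<open>a + b = 1\<close>. The bound is then freed of \<open>\<delta>\<close> by a limit at fixed
  \<open>\<epsilon>\<close>.\<close>

lemma penalized_inequality:
  fixes a b \<epsilon> r P \<kappa> :: real
  assumes sub: "viscosity_subsolution \<nu> j H c l1 u1" "viscosity_subsolution \<nu> j H c l2 u2"
    and sup: "viscosity_supersolution \<nu> j H c l3 v"
    and lip: "\<kappa>-lipschitz_on UNIV u1" "\<kappa>-lipschitz_on UNIV u2" "\<kappa>-lipschitz_on UNIV v"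
    and ab: "a > 0" "b > 0" "a + b = 1" and \<epsilon>: "\<epsilon> > 0"
    and P: "P > 0" "\<And>h k :: real ^ 'n. \<bar>trig_gap (h + k) - trig_gap h - k \<bullet> trig_gap_grad h\<bar> \<le> P * (norm k)\<^sup>2"
    and max: "\<And>x' y' z'. a * u1 x' + b * u2 y' - v z' - coupling_penalty \<epsilon> a b x' y' z'
      \<le> a * u1 x + b * u2 y - v z - coupling_penalty \<epsilon> a b x y z"
    and r: "norm (x - z) \<le> r" "norm (y - z) \<le> r"
  defines "q1 \<equiv> (1 / \<epsilon>) *\<^sub>R trig_gap_grad (x - z)" and "q2 \<equiv> (1 / \<epsilon>) *\<^sub>R trig_gap_grad (y - z)"
  shows "a * l1 * u1 x + b * l2 * u2 y - l3 * v z
    \<le> (P * Cj\<^sup>2 * r\<^sup>2 / \<epsilon> + \<kappa> * r) * (\<integral>\<zeta>. levy_weight \<zeta> \<partial>\<nu>) + \<kappa> * (Ct * r)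
      + (H z (a *\<^sub>R q1 + b *\<^sub>R q2) - a * H x q1 - b * H y q2)"
proof -
  let ?q = "a *\<^sub>R q1 + b *\<^sub>R q2"
  define \<phi>1 where "\<phi>1 = (\<lambda>x'. 1 / \<epsilon> * trig_gap (x' - z))"
  define \<phi>2 where "\<phi>2 = (\<lambda>y'. 1 / \<epsilon> * trig_gap (y' - z))"
  define \<psi> where "\<psi> = (\<lambda>z'. - (a / \<epsilon>) * trig_gap (z' - x) + - (b / \<epsilon>) * trig_gap (z' - y))"
  have C2: "\<phi>1 \<in> C2_torus" "\<phi>2 \<in> C2_torus" "\<psi> \<in> C2_torus"
    unfolding \<phi>1_def \<phi>2_def \<psi>_def by (intro C2_torus_scale C2_torus_lincomb C2_torus_trig_gap)+
  have g1: "grad \<phi>1 x = q1" and g2: "grad \<phi>2 y = q2"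
    unfolding \<phi>1_def \<phi>2_def q1_def q2_def
    by (simp_all only: C2_torus_scale(2)[OF C2_torus_trig_gap] grad_trig_gap)
  have g3: "grad \<psi> z = ?q"
    using trig_gap_grad_commute[of z x] trig_gap_grad_commute[of z y]
    unfolding \<psi>_def q1_def q2_def C2_torus_lincomb(2)[OF C2_torus_trig_gap C2_torus_trig_gap] grad_trig_gap
    by simp
  have C0: "u1 \<in> C0_torus" "u2 \<in> C0_torus" "v \<in> C0_torus"
    using sub sup by (auto simp: viscosity_subsolution_def viscosity_supersolution_def)
  have m1: "u1 x' - \<phi>1 x' \<le> u1 x - \<phi>1 x" for x'
  proof -
    have "a * (u1 x' - \<phi>1 x') \<le> a * (u1 x - \<phi>1 x)"
      using max[of x' y z] by (simp add: coupling_penalty_def \<phi>1_def add_divide_distrib right_diff_distrib)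
    then show ?thesis using ab by simp
  qed
  have m2: "u2 y' - \<phi>2 y' \<le> u2 y - \<phi>2 y" for y'
  proof -
    have "b * (u2 y' - \<phi>2 y') \<le> b * (u2 y - \<phi>2 y)"
      using max[of x y' z] by (simp add: coupling_penalty_def \<phi>2_def add_divide_distrib right_diff_distrib)
    then show ?thesis using ab by simp
  qed
  have m3: "v z - \<psi> z \<le> v z' - \<psi> z'" for z'
    using max[of x y z'] trig_gap_commute[of x z] trig_gap_commute[of y z]
      trig_gap_commute[of x z'] trig_gap_commute[of y z']
    by (simp add: coupling_penalty_def \<psi>_def add_divide_distrib)
  define G where "G \<delta> \<zeta> = 2 * P * Cj\<^sup>2 / \<epsilon> * small_jumps \<delta> \<zeta>
      + (P * Cj\<^sup>2 * r\<^sup>2 / \<epsilon> + \<kappa> * r) * levy_weight \<zeta> + \<kappa> * (a * tail_gap x z \<zeta> + b * tail_gap y z \<zeta>)"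
    for \<delta> \<zeta>
  define E where "E = (P * Cj\<^sup>2 * r\<^sup>2 / \<epsilon> + \<kappa> * r) * (\<integral>\<zeta>. levy_weight \<zeta> \<partial>\<nu>) + \<kappa> * (Ct * r)"
  have \<kappa>: "\<kappa> \<ge> 0" using lip(1) by (rule lipschitz_on_nonneg)
  have main: "a * l1 * u1 x + b * l2 * u2 y - l3 * v z
      \<le> 2 * P * Cj\<^sup>2 / \<epsilon> * (\<integral>\<zeta>. small_jumps \<delta> \<zeta> \<partial>\<nu>) + (E + (H z ?q - a * H x q1 - b * H y q2))"
    if \<delta>: "0 < \<delta>" "\<delta> \<le> 1" for \<delta>
  proof -
    let ?S1 = "incr_split \<delta> \<phi>1 u1 q1 x" and ?S2 = "incr_split \<delta> \<phi>2 u2 q2 y" and ?S3 = "incr_split \<delta> \<psi> v ?q z"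
    have I: "integrable \<nu> ?S1" "integrable \<nu> ?S2" "integrable \<nu> ?S3"
      using incr_split_integrable[OF C2(1) C0(1) \<delta>, of x] incr_split_integrable[OF C2(2) C0(2) \<delta>, of y]
        incr_split_integrable[OF C2(3) C0(3) \<delta>, of z] by (simp_all add: g1 g2 g3)
    have i1: "l1 * u1 x - (\<integral>\<zeta>. ?S1 \<zeta> \<partial>\<nu>) + H x q1 \<le> c"
      using subsolution_split[OF sub(1) lip(1) C2(1) m1 \<delta>] by (simp add: g1)
    have i2: "l2 * u2 y - (\<integral>\<zeta>. ?S2 \<zeta> \<partial>\<nu>) + H y q2 \<le> c"
      using subsolution_split[OF sub(2) lip(2) C2(2) m2 \<delta>] by (simp add: g2)
    have i3: "c \<le> l3 * v z - (\<integral>\<zeta>. ?S3 \<zeta> \<partial>\<nu>) + H z ?q"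
      using supersolution_split[OF sup lip(3) C2(3) m3 \<delta>] by (simp add: g3)
    have "a * (\<integral>\<zeta>. ?S1 \<zeta> \<partial>\<nu>) + b * (\<integral>\<zeta>. ?S2 \<zeta> \<partial>\<nu>) - (\<integral>\<zeta>. ?S3 \<zeta> \<partial>\<nu>)
        = (\<integral>\<zeta>. a * ?S1 \<zeta> + b * ?S2 \<zeta> - ?S3 \<zeta> \<partial>\<nu>)"
      using I by simp
    also have "\<dots> \<le> (\<integral>\<zeta>. G \<delta> \<zeta> \<partial>\<nu>)"
    proof (rule integral_mono)
      show "integrable \<nu> (\<lambda>\<zeta>. a * ?S1 \<zeta> + b * ?S2 \<zeta> - ?S3 \<zeta>)" using I by simp
      show "integrable \<nu> (G \<delta>)"
        unfolding G_def using small_jumps_integrable[OF \<delta>(2)] levy_weight_integrable tail_gap_integral(1) by simp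
      show "a * ?S1 \<zeta> + b * ?S2 \<zeta> - ?S3 \<zeta> \<le> G \<delta> \<zeta>" for \<zeta>
        unfolding G_def \<phi>1_def \<phi>2_def \<psi>_def q1_def q2_def
        by (rule penalized_integrand_bound[OF ab \<epsilon> \<delta> lip(1,2) P max r])
    qed
    also have "\<dots> = 2 * P * Cj\<^sup>2 / \<epsilon> * (\<integral>\<zeta>. small_jumps \<delta> \<zeta> \<partial>\<nu>)
        + (P * Cj\<^sup>2 * r\<^sup>2 / \<epsilon> + \<kappa> * r) * (\<integral>\<zeta>. levy_weight \<zeta> \<partial>\<nu>)
        + \<kappa> * (a * (\<integral>\<zeta>. tail_gap x z \<zeta> \<partial>\<nu>) + b * (\<integral>\<zeta>. tail_gap y z \<zeta> \<partial>\<nu>))"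
      unfolding G_def using small_jumps_integrable[OF \<delta>(2)] levy_weight_integrable tail_gap_integral(1) by simp
    also have "\<dots> \<le> 2 * P * Cj\<^sup>2 / \<epsilon> * (\<integral>\<zeta>. small_jumps \<delta> \<zeta> \<partial>\<nu>) + E"
    proof -
      have "(\<integral>\<zeta>. tail_gap w z \<zeta> \<partial>\<nu>) \<le> Ct * r" if "norm (w - z) \<le> r" for w
        using tail_gap_integral(2)[of w z] that Ct_pos
        by (meson mult_left_mono less_imp_le order_trans)
      then have "a * (\<integral>\<zeta>. tail_gap x z \<zeta> \<partial>\<nu>) + b * (\<integral>\<zeta>. tail_gap y z \<zeta> \<partial>\<nu>) \<le> a * (Ct * r) + b * (Ct * r)"
        using r ab by (intro add_mono mult_left_mono) auto
      also have "\<dots> = Ct * r" using ab by (simp flip: distrib_right)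
      finally show ?thesis using \<kappa> by (simp add: E_def mult_left_mono)
    qed
    finally have I_le: "a * (\<integral>\<zeta>. ?S1 \<zeta> \<partial>\<nu>) + b * (\<integral>\<zeta>. ?S2 \<zeta> \<partial>\<nu>) - (\<integral>\<zeta>. ?S3 \<zeta> \<partial>\<nu>)
      \<le> 2 * P * Cj\<^sup>2 / \<epsilon> * (\<integral>\<zeta>. small_jumps \<delta> \<zeta> \<partial>\<nu>) + E" .
    have "a * (l1 * u1 x - (\<integral>\<zeta>. ?S1 \<zeta> \<partial>\<nu>) + H x q1) + b * (l2 * u2 y - (\<integral>\<zeta>. ?S2 \<zeta> \<partial>\<nu>) + H y q2)
        \<le> a * c + b * c"
      using i1 i2 ab by (intro add_mono mult_left_mono) auto
    also have "\<dots> = c" using ab by (simp flip: distrib_right)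
    finally show ?thesis using i3 I_le by (simp add: algebra_simps)
  qed
  \<comment> \<open>Only the small-jump integral depends on \<open>\<delta>\<close>; its coefficient
    is of order \<open>1 / \<epsilon>\<close>, so this limit must precede the one in
    \<open>\<epsilon>\<close>.\<close>
  have "(\<lambda>k. 2 * P * Cj\<^sup>2 / \<epsilon> * (\<integral>\<zeta>. small_jumps (1 / real (Suc k)) \<zeta> \<partial>\<nu>)
      + (E + (H z ?q - a * H x q1 - b * H y q2)))
    \<longlonglongrightarrow> 2 * P * Cj\<^sup>2 / \<epsilon> * 0 + (E + (H z ?q - a * H x q1 - b * H y q2))"
    by (intro tendsto_intros small_jumps_tendsto_0)
  moreover have "a * l1 * u1 x + b * l2 * u2 y - l3 * v z
      \<le> 2 * P * Cj\<^sup>2 / \<epsilon> * (\<integral>\<zeta>. small_jumps (1 / real (Suc k)) \<zeta> \<partial>\<nu>)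
        + (E + (H z ?q - a * H x q1 - b * H y q2))" for k
    by (rule main) auto
  ultimately have "a * l1 * u1 x + b * l2 * u2 y - l3 * v z
      \<le> 2 * P * Cj\<^sup>2 / \<epsilon> * 0 + (E + (H z ?q - a * H x q1 - b * H y q2))"
    using LIMSEQ_le_const by blast
  then show ?thesis by (simp add: E_def)
qed

end

text \<open>Moving \<open>x\<close> to \<open>z\<close> cannot raise the functional, so 8 |x - z|^2
  <= \<kappa> \<epsilon> |x - z|. The Lipschitz bound thus gives a rate linear in
  \<open>\<epsilon>\<close>.\<close>

lemma penalized_max_close:
  fixes u :: "real ^ 'n::finite \<Rightarrow> real"
  assumes lip: "\<kappa>-lipschitz_on UNIV u" and "a > 0" "\<epsilon> > 0" and cell: "x - z \<in> unit_cell"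
    and le: "a * u z \<le> a * u x - a * trig_gap (x - z) / \<epsilon>"
  shows "norm (x - z) \<le> \<kappa> * \<epsilon> / 8"
proof -
  have "a * (trig_gap (x - z) / \<epsilon>) \<le> a * (u x - u z)" using le by (simp add: algebra_simps)
  then have "trig_gap (x - z) / \<epsilon> \<le> u x - u z" using \<open>a > 0\<close> mult_le_cancel_left_pos by blast
  also have "\<dots> \<le> \<kappa> * norm (x - z)" by (rule lipschitz_real_le[OF lip])
  finally have "trig_gap (x - z) \<le> \<kappa> * norm (x - z) * \<epsilon>" using \<open>\<epsilon> > 0\<close> by (simp add: field_simps)
  then have "norm (x - z) * (8 * norm (x - z)) \<le> norm (x - z) * (\<kappa> * \<epsilon>)"
    using trig_gap_lower[OF cell] by (simp add: power2_eq_square mult_ac)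
  moreover have "0 \<le> \<kappa> * \<epsilon>" using lipschitz_on_nonneg[OF lip] \<open>\<epsilon> > 0\<close> by simp
  ultimately show ?thesis by (cases "norm (x - z) = 0") auto
qed

lemma uniformly_continuous_on_compact_pair:
  fixes H :: "real ^ 'n::finite \<Rightarrow> real ^ 'n \<Rightarrow> real"
  assumes H: "continuous_on UNIV (\<lambda>(x, p). H x p)" and "\<eta> > 0"
  obtains d where "d > 0"
    "\<And>x z p. z \<in> unit_cell \<Longrightarrow> x - z \<in> unit_cell \<Longrightarrow> norm (x - z) < d \<Longrightarrow> norm p \<le> Q \<Longrightarrow> \<bar>H z p - H x p\<bar> < \<eta>"
proof -
  obtain B where B: "\<And>h :: real ^ 'n. h \<in> unit_cell \<Longrightarrow> norm h \<le> B"
    using compact_imp_bounded[OF compact_unit_cell] unfolding bounded_iff by blast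
  let ?S = "cball 0 (2 * B) \<times> cball 0 Q :: ((real ^ 'n) \<times> (real ^ 'n)) set"
  have "uniformly_continuous_on ?S (\<lambda>(x, p). H x p)"
    by (intro compact_uniformly_continuous continuous_on_subset[OF H] compact_Times) auto
  then obtain d where d: "d > 0"
    "\<forall>s\<in>?S. \<forall>t\<in>?S. dist t s < d \<longrightarrow> dist ((\<lambda>(x, p). H x p) t) ((\<lambda>(x, p). H x p) s) < \<eta>"
    using \<open>\<eta> > 0\<close> unfolding uniformly_continuous_on_def by meson
  show thesis
  proof (rule that[OF d(1)])
    fix x z p :: "real ^ 'n"
    assume a: "z \<in> unit_cell" "x - z \<in> unit_cell" "norm (x - z) < d" "norm p \<le> Q"
    have "norm x \<le> norm (x - z) + norm z" using norm_triangle_ineq[of "x - z" z] by simp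
    then have "norm x \<le> 2 * B" "norm z \<le> 2 * B"
      using B[OF a(1)] B[OF a(2)] norm_ge_zero[of "x - z"] by linarith+
    then have "(x, p) \<in> ?S" "(z, p) \<in> ?S" using a(4) by auto
    moreover have "dist (z, p) (x, p) < d" using a(3) by (simp add: dist_Pair_Pair dist_norm norm_minus_commute)
    ultimately show "\<bar>H z p - H x p\<bar> < \<eta>" using d(2) by (fastforce simp: dist_real_def)
  qed
qed

context levy_jumps
begin

text \<open>The discounts may all differ. \<open>L\<close> is a reference rate: \<open>gap\<close>
  bounds the mismatch between \<open>L\<close> and the actual discounts at a single common point, so
  for instance discount 0 is allowed for one of the functions.\<close>

lemma comparison_convex:
  fixes a b \<kappa> K L :: real
  assumes sub: "viscosity_subsolution \<nu> j H c l1 u1" "viscosity_subsolution \<nu> j H c l2 u2"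
    and sup: "viscosity_supersolution \<nu> j H c l3 v"
    and lip: "\<kappa>-lipschitz_on UNIV u1" "\<kappa>-lipschitz_on UNIV u2" "\<kappa>-lipschitz_on UNIV v"
    and H: "continuous_on UNIV (\<lambda>(x, p). H x p)" and conv: "\<And>x. convex_on UNIV (H x)"
    and ab: "a > 0" "b > 0" "a + b = 1" and L: "L > 0"
    and gap: "\<And>z. a * (L - l1) * u1 z + b * (L - l2) * u2 z - (L - l3) * v z \<le> L * K"
  shows "a * u1 w + b * u2 w - v w \<le> K"
proof -
  have C0: "u1 \<in> C0_torus" "u2 \<in> C0_torus" "v \<in> C0_torus"
    using sub sup by (auto simp: viscosity_subsolution_def viscosity_supersolution_def)
  have \<kappa>: "\<kappa> \<ge> 0" using lip(1) by (rule lipschitz_on_nonneg)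
  obtain P where P: "P > 0"
    "\<And>h k :: real ^ 'n. \<bar>trig_gap (h + k) - trig_gap h - k \<bullet> trig_gap_grad h\<bar> \<le> P * (norm k)\<^sup>2"
    by (rule trig_gap_taylor) (rule that; blast)
  define W where "W = (\<integral>\<zeta>. levy_weight \<zeta> \<partial>\<nu>)"
  have W: "W \<ge> 0" unfolding W_def by (rule integral_nonneg_AE) (simp add: levy_weight_nonneg)
  \<comment> \<open>The penalty gradient is at most 4 pi^2 r / \<epsilon>, with r = \<kappa>
    \<epsilon> / 8.\<close>
  define Q where "Q = pi\<^sup>2 * \<kappa> / 2"
  \<comment> \<open>The coefficient of \<open>\<epsilon>\<close> in the total error: r^2 /
    \<epsilon> = \<kappa>^2 \<epsilon> / 64 and \<kappa> r = \<kappa>^2 \<epsilon> / 8. The last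
    summand moves the discount mismatch from \<open>x\<close>, \<open>y\<close> to
    \<open>z\<close>.\<close>
  define T where "T = (P * Cj\<^sup>2 * \<kappa>\<^sup>2 / 64 + \<kappa>\<^sup>2 / 8) * W + \<kappa>\<^sup>2 * Ct / 8
      + (a * \<bar>L - l1\<bar> + b * \<bar>L - l2\<bar>) * \<kappa>\<^sup>2 / 8"
  have T: "T \<ge> 0" using P(1) W Ct_pos ab unfolding T_def by simp
  have "L * (a * u1 w + b * u2 w - v w) \<le> L * K + \<eta>" if \<eta>: "\<eta> > 0" for \<eta>
  proof -
    obtain d where d: "d > 0"
      "\<And>x z p. z \<in> unit_cell \<Longrightarrow> x - z \<in> unit_cell \<Longrightarrow> norm (x - z) < d \<Longrightarrow> norm p \<le> Q \<Longrightarrow> \<bar>H z p - H x p\<bar> < \<eta> / 2"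
      by (rule uniformly_continuous_on_compact_pair[OF H, of "\<eta> / 2" Q]) (use \<eta> in auto)
    \<comment> \<open>The first entry brings the points within the modulus \<open>d\<close> of
      \<open>H\<close>, the second makes \<epsilon> T <= \<eta> / 2; adding 1 avoids division by
      zero.\<close>
    define \<epsilon> where "\<epsilon> = min (4 * d / (\<kappa> + 1)) (\<eta> / (2 * (T + 1)))"
    have \<epsilon>: "\<epsilon> > 0" using d \<kappa> T \<eta> by (simp add: \<epsilon>_def)
    have "\<kappa> * \<epsilon> \<le> (\<kappa> + 1) * (4 * d / (\<kappa> + 1))" using \<kappa> \<epsilon> d by (intro mult_mono) (auto simp: \<epsilon>_def)
    then have rd: "\<kappa> * \<epsilon> / 8 < d" using \<kappa> d by simp
    have "\<epsilon> * T \<le> (\<eta> / (2 * (T + 1))) * (T + 1)" using T \<eta> by (intro mult_mono) (auto simp: \<epsilon>_def)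
    also have "\<dots> = \<eta> / 2" using T by (simp add: field_simps)
    finally have eT: "\<epsilon> * T \<le> \<eta> / 2" .
    obtain x y z where cell: "x - z \<in> unit_cell" "y - z \<in> unit_cell" "z \<in> unit_cell"
      and max: "\<And>x' y' z'. a * u1 x' + b * u2 y' - v z' - coupling_penalty \<epsilon> a b x' y' z'
        \<le> a * u1 x + b * u2 y - v z - coupling_penalty \<epsilon> a b x y z"
      by (rule penalized_max_exists[OF C0, of a b \<epsilon>]) (rule that; blast)
    define r where "r = \<kappa> * \<epsilon> / 8"
    have r: "norm (x - z) \<le> r" "norm (y - z) \<le> r"
      unfolding r_def
      using max[of z y z] max[of x z z] ab
      by (intro penalized_max_close[OF lip(1) ab(1) \<epsilon> cell(1)] penalized_max_close[OF lip(2) ab(2) \<epsilon> cell(2)];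
          simp add: coupling_penalty_def add_divide_distrib)+
    define q1 where "q1 = (1 / \<epsilon>) *\<^sub>R trig_gap_grad (x - z)"
    define q2 where "q2 = (1 / \<epsilon>) *\<^sub>R trig_gap_grad (y - z)"
    have q: "norm ((1 / \<epsilon>) *\<^sub>R trig_gap_grad h) \<le> Q" if "norm h \<le> r" for h :: "real ^ 'n"
    proof -
      have "norm (trig_gap_grad h) \<le> 4 * pi\<^sup>2 * norm h" by (rule norm_trig_gap_grad_le)
      also have "\<dots> \<le> 4 * pi\<^sup>2 * r" using that by (intro mult_left_mono) auto
      also have "\<dots> = Q * \<epsilon>" by (simp add: r_def Q_def)
      finally show ?thesis using \<epsilon> by (simp add: field_simps)
    qed
    have "norm (x - z) < d" "norm (y - z) < d" using r rd by (auto simp: r_def)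
    moreover have "norm q1 \<le> Q" "norm q2 \<le> Q" unfolding q1_def q2_def by (rule q, rule r)+
    ultimately have "\<bar>H z q1 - H x q1\<bar> < \<eta> / 2" "\<bar>H z q2 - H y q2\<bar> < \<eta> / 2"
      using d(2)[OF cell(3,1)] d(2)[OF cell(3,2)] by blast+
    then have Hx: "H z q1 - H x q1 < \<eta> / 2" and Hy: "H z q2 - H y q2 < \<eta> / 2" by linarith+
    \<comment> \<open>Convexity is applied at the common point \<open>z\<close>; the change of base
      point from \<open>x\<close>, \<open>y\<close> to \<open>z\<close> is absorbed by uniform
      continuity, since \<open>q1\<close> and \<open>q2\<close> stay in the ball of radius
      \<open>Q\<close>.\<close>
    have "H z (a *\<^sub>R q1 + b *\<^sub>R q2) \<le> a * H z q1 + b * H z q2"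
      using conv[of z] ab unfolding convex_on_def by simp
    moreover have "a * (H z q1 - H x q1) + b * (H z q2 - H y q2) \<le> a * (\<eta> / 2) + b * (\<eta> / 2)"
      using Hx Hy ab by (intro add_mono mult_left_mono) auto
    moreover have "a * (\<eta> / 2) + b * (\<eta> / 2) = \<eta> / 2" using ab by (simp flip: distrib_right)
    ultimately have Hd: "H z (a *\<^sub>R q1 + b *\<^sub>R q2) - a * H x q1 - b * H y q2 \<le> \<eta> / 2"
      by (simp add: right_diff_distrib)
    have ineq: "a * l1 * u1 x + b * l2 * u2 y - l3 * v z
        \<le> (P * Cj\<^sup>2 * r\<^sup>2 / \<epsilon> + \<kappa> * r) * W + \<kappa> * (Ct * r) + \<eta> / 2"
      using penalized_inequality[OF sub sup lip ab \<epsilon> P max r] Hd unfolding W_def q1_def q2_def by linarith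
    have "a * u1 w + b * u2 w - v w \<le> a * u1 x + b * u2 y - v z - coupling_penalty \<epsilon> a b x y z"
      using max[of w w w] by (simp add: coupling_penalty_def)
    also have "\<dots> \<le> a * u1 x + b * u2 y - v z"
      using coupling_penalty_nonneg[of \<epsilon> a b x y z] ab \<epsilon> by simp
    finally have "L * (a * u1 w + b * u2 w - v w) \<le> L * (a * u1 x + b * u2 y - v z)"
      using L by (intro mult_left_mono) auto
    also have "\<dots> = (a * l1 * u1 x + b * l2 * u2 y - l3 * v z)
        + (a * (L - l1) * u1 z + b * (L - l2) * u2 z - (L - l3) * v z)
        + (a * ((L - l1) * (u1 x - u1 z)) + b * ((L - l2) * (u2 y - u2 z)))"
      by (simp add: algebra_simps)
    also have "\<dots> \<le> ((P * Cj\<^sup>2 * r\<^sup>2 / \<epsilon> + \<kappa> * r) * W + \<kappa> * (Ct * r) + \<eta> / 2) + L * K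
        + (a * (\<bar>L - l1\<bar> * (\<kappa> * r)) + b * (\<bar>L - l2\<bar> * (\<kappa> * r)))"
    proof (intro add_mono ineq gap mult_left_mono)
      have "m * (u s - u z) \<le> \<bar>m\<bar> * (\<kappa> * r)" if "\<kappa>-lipschitz_on UNIV u" "norm (s - z) \<le> r"
        for m s and u :: "real ^ 'n \<Rightarrow> real"
      proof -
        have "\<bar>u s - u z\<bar> \<le> \<kappa> * norm (s - z)"
          using lipschitz_onD[OF that(1), of s z] by (simp add: dist_norm)
        also have "\<dots> \<le> \<kappa> * r" using that(2) \<kappa> by (rule mult_left_mono)
        finally have "\<bar>m\<bar> * \<bar>u s - u z\<bar> \<le> \<bar>m\<bar> * (\<kappa> * r)" by (rule mult_left_mono) simp
        then show ?thesis using abs_ge_self[of "m * (u s - u z)"] by (simp add: abs_mult)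
      qed
      then show "(L - l1) * (u1 x - u1 z) \<le> \<bar>L - l1\<bar> * (\<kappa> * r)"
        "(L - l2) * (u2 y - u2 z) \<le> \<bar>L - l2\<bar> * (\<kappa> * r)" using lip r by blast+
    qed (use ab in auto)
    also have "\<dots> = \<epsilon> * T + \<eta> / 2 + L * K"
      using \<epsilon> unfolding r_def T_def by (simp add: field_simps power2_eq_square)
    finally show ?thesis using eT by linarith
  qed
  then have "L * (a * u1 w + b * u2 w - v w) \<le> L * K" by (rule field_le_epsilon)
  then show ?thesis using L by simp
qed

end

section \<open>The vanishing discount limit\<close>

text \<open>Arzela-Ascoli on the cell controls the limit only there. It is extended by reading it at
  a chosen representative \<open>x + m x\<close>; periodicity of the approximants carries the
  uniform convergence over.\<close>

lemma periodic_equilipschitz_subsequence: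
  fixes f :: "nat \<Rightarrow> real ^ 'n::finite \<Rightarrow> real"
  assumes per: "\<And>k. periodic (f k)" and lip: "\<And>k. \<kappa>-lipschitz_on UNIV (f k)"
    and bd: "\<And>k x. \<bar>f k x\<bar> \<le> M"
  obtains g \<rho> where "strict_mono (\<rho> :: nat \<Rightarrow> nat)" "uniform_limit UNIV (\<lambda>k. f (\<rho> k)) g sequentially"
proof -
  have \<kappa>: "\<kappa> \<ge> 0" using lip[of 0] by (rule lipschitz_on_nonneg)
  obtain g \<rho> where \<rho>: "strict_mono (\<rho> :: nat \<Rightarrow> nat)"
    and lim: "\<And>e. 0 < e \<Longrightarrow> \<exists>N. \<forall>n x. n \<ge> N \<and> x \<in> unit_cell \<longrightarrow> norm (f (\<rho> n) x - g x) < e"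
  proof (rule Arzela_Ascoli[of "unit_cell :: (real ^ 'n) set" f M])
    show "\<exists>d>0. \<forall>n y. y \<in> unit_cell \<and> norm (x - y) < d \<longrightarrow> norm (f n x - f n y) < e"
      if "e > 0" for x :: "real ^ 'n" and e
    proof (intro exI[of _ "e / (\<kappa> + 1)"] conjI allI impI)
      fix n and y :: "real ^ 'n" assume "y \<in> unit_cell \<and> norm (x - y) < e / (\<kappa> + 1)"
      then have "norm (x - y) < e / (\<kappa> + 1)" by simp
      moreover have "norm (f n x - f n y) \<le> \<kappa> * norm (x - y)"
        using lipschitz_onD[OF lip, of x y n] by (simp add: dist_norm)
      ultimately show "norm (f n x - f n y) < e"
        using \<kappa> by (smt (verit, best) mult_left_mono norm_ge_zero pos_less_divide_eq mult.commute)
    qed (use that \<kappa> in simp)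
  qed (use bd compact_unit_cell in auto)
  have "\<exists>m. (\<forall>i. m $ i \<in> \<int>) \<and> x + m \<in> unit_cell" for x :: "real ^ 'n"
    using shift_into_unit_cell by blast
  then obtain m :: "real ^ 'n \<Rightarrow> real ^ 'n" where m: "\<And>x i. m x $ i \<in> \<int>" "\<And>x. x + m x \<in> unit_cell"
    by metis
  have fm: "f k (x + m x) = f k x" for k x by (rule periodicD[OF per m(1)])
  have "uniform_limit UNIV (\<lambda>k. f (\<rho> k)) (\<lambda>x. g (x + m x)) sequentially"
    unfolding uniform_limit_sequentially_iff
  proof (intro allI impI)
    fix e :: real assume "e > 0"
    from lim[OF this] obtain N where
      N: "\<forall>n x. n \<ge> N \<and> x \<in> unit_cell \<longrightarrow> norm (f (\<rho> n) x - g x) < e" ..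
    have "dist (f (\<rho> n) x) (g (x + m x)) < e" if "n \<ge> N" for n x
      using N[rule_format, of n "x + m x"] that m(2) fm by (simp add: dist_norm)
    then show "\<exists>N. \<forall>n\<ge>N. \<forall>x\<in>UNIV. dist (f (\<rho> n) x) (g (x + m x)) < e" by blast
  qed
  with \<rho> show thesis by (rule that)
qed

context levy_jumps
begin

text \<open>The convex comparison with the same subsolution entered twice, each with weight
  1/2.\<close>

lemma comparison:
  assumes sub: "viscosity_subsolution \<nu> j H c l1 u" and sup: "viscosity_supersolution \<nu> j H c l3 v"
    and lip: "\<kappa>-lipschitz_on UNIV u" "\<kappa>-lipschitz_on UNIV v"
    and H: "continuous_on UNIV (\<lambda>(x, p). H x p)" and conv: "\<And>x. convex_on UNIV (H x)"
    and L: "L > 0" and gap: "\<And>z. (L - l1) * u z - (L - l3) * v z \<le> L * K"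
  shows "u w - v w \<le> K"
proof -
  have half: "1 / 2 * s + 1 / 2 * s = s" for s :: real by simp
  have "1 / 2 * u w + 1 / 2 * u w - v w \<le> K"
  proof (rule comparison_convex[OF sub sub sup lip(1,1,2) H conv _ _ _ L])
    show "1 / 2 * (L - l1) * u z + 1 / 2 * (L - l1) * u z - (L - l3) * v z \<le> L * K" for z
      using gap[of z] unfolding mult.assoc half .
  qed simp_all
  then show ?thesis unfolding half .
qed

text \<open>With \<open>\<theta> = l / m\<close> the averaged discount (1 - \<theta>) 0 + \<theta> m
  equals \<open>l\<close>, and the mismatch reduces to l (1 - \<theta>) (v - um) <= l D. The bound
  is uniform over all \<open>l < m\<close>, which is what passes information from one vanishing
  sequence of discounts to another.\<close>

lemma discounted_lower_bound:
  assumes sol: "viscosity_solution \<nu> j H c 0 v" "viscosity_solution \<nu> j H c m um"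
      "viscosity_solution \<nu> j H c l ul"
    and lip: "\<kappa>-lipschitz_on UNIV v" "\<kappa>-lipschitz_on UNIV um" "\<kappa>-lipschitz_on UNIV ul"
    and H: "continuous_on UNIV (\<lambda>(x, p). H x p)" and conv: "\<And>x. convex_on UNIV (H x)"
    and lm: "0 < l" "l < m" and D: "\<And>x. \<bar>um x - v x\<bar> \<le> D"
  shows "v x - 2 * D \<le> ul x"
proof -
  define \<theta> where "\<theta> = l / m"
  have \<theta>: "0 < \<theta>" "\<theta> < 1" "\<theta> * m = l" using lm by (auto simp: \<theta>_def)
  have contract: "s * t \<le> D" if "0 \<le> s" "s \<le> 1" "\<bar>t\<bar> \<le> D" for s t
    using mult_mono[of s 1 "\<bar>t\<bar>" D] abs_ge_self[of "s * t"] that by (simp add: abs_mult)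
  have "(1 - \<theta>) * v x + \<theta> * um x - ul x \<le> D"
  proof (rule comparison_convex[OF _ _ _ lip H conv, where L = l])
    show "viscosity_subsolution \<nu> j H c 0 v" "viscosity_subsolution \<nu> j H c m um"
      "viscosity_supersolution \<nu> j H c l ul"
      using sol by (auto simp: viscosity_solution_def)
    show "(1 - \<theta>) * (l - 0) * v z + \<theta> * (l - m) * um z - (l - l) * ul z \<le> l * D" for z
    proof -
      have "\<theta> * (l - m) = - ((1 - \<theta>) * l)" using \<theta>(3) by (simp add: algebra_simps)
      then have "(1 - \<theta>) * (l - 0) * v z + \<theta> * (l - m) * um z - (l - l) * ul z
          = l * ((1 - \<theta>) * (v z - um z))" by (simp add: algebra_simps)
      also have "(1 - \<theta>) * (v z - um z) \<le> D"
        by (rule contract) (use \<theta> D[of z] in auto)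
      finally show ?thesis using lm by simp
    qed
  qed (use \<theta> lm in auto)
  moreover have "\<theta> * (v x - um x) \<le> D"
    by (rule contract) (use \<theta> D[of x] in auto)
  ultimately show ?thesis by (simp add: algebra_simps)
qed

lemma vanishing_discount:
  assumes H: "continuous_on UNIV (\<lambda>(x, p). H x p)" and conv: "\<And>x. convex_on UNIV (H x)"
    and ex: "\<And>l. l \<in> {0..<1} \<Longrightarrow> \<exists>u. viscosity_solution \<nu> j H c l u"
    and lip: "\<And>l u. l \<in> {0..<1} \<Longrightarrow> viscosity_solution \<nu> j H c l u \<Longrightarrow> \<kappa>-lipschitz_on UNIV u"
  shows "(\<forall>l\<in>{0<..<1}. \<exists>!u. viscosity_solution \<nu> j H c l u) \<and>
     (\<exists>u0. viscosity_solution \<nu> j H c 0 u0 \<and>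
        uniform_limit UNIV (\<lambda>l. THE u. viscosity_solution \<nu> j H c l u) u0 (at_right 0))"
proof -
  let ?sol = "viscosity_solution \<nu> j H c"
  have le: "u w \<le> v w" if "l \<in> {0<..<1}" "?sol l u" "?sol l v" for l u v w
  proof -
    have l: "l \<in> {0..<1}" "0 < l" using that(1) by auto
    have "u w - v w \<le> 0"
      by (rule comparison[OF _ _ lip[OF l(1) that(2)] lip[OF l(1) that(3)] H conv l(2)])
        (use that(2,3) in \<open>auto simp: viscosity_solution_def\<close>)
    then show ?thesis by simp
  qed
  have unique: "\<exists>!u. ?sol l u" if "l \<in> {0<..<1}" for l
  proof -
    have "\<exists>u. ?sol l u" using ex[of l] that by simp
    then obtain u where u: "?sol l u" ..
    show ?thesis
    proof (rule ex1I[of _ u])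
      show "v = u" if "?sol l v" for v
        using le[OF \<open>l \<in> {0<..<1}\<close>] that u by (intro ext antisym)
    qed (rule u)
  qed
  define U where "U l = (THE u. ?sol l u)" for l
  have U: "?sol l (U l)" if "l \<in> {0<..<1}" for l
    unfolding U_def by (rule theI'[OF unique[OF that]])
  have Ulip: "\<kappa>-lipschitz_on UNIV (U l)" if "l \<in> {0<..<1}" for l
    using lip[OF _ U[OF that]] that by simp
  have per: "periodic u" "continuous_on UNIV u" if "?sol l u" for l u
    using that by (auto simp: viscosity_solution_def viscosity_subsolution_def C0_torus_def)
  obtain u where u: "?sol 0 u" using ex[of 0] by auto
  have ulip: "\<kappa>-lipschitz_on UNIV u" using lip[OF _ u] by simp
  obtain B where B: "B > 0" "\<And>x. norm (u x) \<le> B" using periodic_bounded[OF per[OF u]] by blast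
  \<comment> \<open>A solution \<open>u\<close> of the undiscounted equation, raised or lowered by a
    bound \<open>B\<close> of |u|, acts as a barrier for every discount. The resulting bound does
    not depend on \<open>l\<close>, as compactness requires.\<close>
  have Ubd: "\<bar>U l x\<bar> \<le> 2 * B" if l: "l \<in> {0<..<1}" for l x
  proof -
    have lu: "l * u z \<le> l * B" "- (l * u z) \<le> l * B" for z
      using B(2)[of z] l mult_left_mono[of "u z" B l] mult_left_mono[of "- u z" B l] by auto
    have "U l x - u x \<le> B"
      by (rule comparison[OF _ _ Ulip[OF l] ulip H conv, where L = l])
        (use U[OF l] u l lu in \<open>auto simp: viscosity_solution_def\<close>)
    moreover have "u x - U l x \<le> B"
      by (rule comparison[OF _ _ ulip Ulip[OF l] H conv, where L = l])
        (use U[OF l] u l lu in \<open>auto simp: viscosity_solution_def\<close>)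
    ultimately show ?thesis using B(2)[of x] by (simp add: abs_le_iff)
  qed
  have cluster: "\<exists>v \<rho>. strict_mono (\<rho> :: nat \<Rightarrow> nat) \<and> ?sol 0 v \<and>
      uniform_limit UNIV (\<lambda>k. U (X (\<rho> k))) v sequentially"
    if X: "\<And>k. X k \<in> {0<..<1}" "X \<longlonglongrightarrow> 0" for X :: "nat \<Rightarrow> real"
  proof -
    obtain v \<rho> where v: "strict_mono (\<rho> :: nat \<Rightarrow> nat)" "uniform_limit UNIV (\<lambda>k. U (X (\<rho> k))) v sequentially"
      using periodic_equilipschitz_subsequence[of "\<lambda>k. U (X k)" \<kappa> "2 * B"] per(1) U[OF X(1)] Ulip[OF X(1)]
        Ubd[OF X(1)] by metis
    have "(\<lambda>k. X (\<rho> k)) \<longlonglongrightarrow> 0" using LIMSEQ_subseq_LIMSEQ[OF X(2) v(1)] by (simp add: o_def)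
    then have "?sol 0 v" by (rule solution_uniform_limit[OF U[OF X(1)] _ v(2) H])
    with v show ?thesis by blast
  qed
  \<comment> \<open>A limit along one sequence is, up to \<open>e\<close>, a lower bound for
    \<open>U l\<close> at all small \<open>l\<close>: one fixed \<open>m = X k\<close> with |U m -
    v| <= e / 2 suffices.\<close>
  have lower: "\<forall>\<^sub>F l in at_right 0. \<forall>x. v x - e \<le> U l x"
    if X: "\<And>k. X k \<in> {0<..<1}" and v: "?sol 0 v" "uniform_limit UNIV (\<lambda>k. U (X k)) v sequentially"
      and e: "e > 0" for X :: "nat \<Rightarrow> real" and v e
  proof -
    have "\<forall>\<^sub>F k in sequentially. \<forall>x\<in>UNIV. dist (U (X k) x) (v x) < e / 2"
      using uniform_limitD[OF v(2) half_gt_zero[OF e]] .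
    then obtain k where k: "\<And>x. dist (U (X k) x) (v x) < e / 2"
      using eventually_happens'[OF sequentially_bot] by blast
    have "v x - 2 * (e / 2) \<le> U l x" if l: "0 < l" "l < X k" for l x
    proof (rule discounted_lower_bound[OF v(1) U[OF X[of k]] U _ Ulip[OF X[of k]] Ulip H conv])
      show "\<kappa>-lipschitz_on UNIV v" using lip[OF _ v(1)] by simp
      show "\<bar>U (X k) y - v y\<bar> \<le> e / 2" for y using k[of y] by (simp add: dist_real_def)
    qed (use l X[of k] in auto)
    then show ?thesis
      using X[of k] unfolding eventually_at_right[OF zero_less_one] by (intro exI[of _ "X k"]) auto
  qed
  \<comment> \<open>The offset of two keeps the value 1 out of the sequence.\<close>
  define X0 :: "nat \<Rightarrow> real" where "X0 k = 1 / real (Suc (Suc k))" for k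
  have X0: "X0 k \<in> {0<..<1}" for k by (simp add: X0_def)
  have X0lim: "X0 \<longlonglongrightarrow> 0"
    unfolding X0_def using LIMSEQ_ignore_initial_segment[OF lim_const_over_n[of 1], of 2] by simp
  obtain v \<rho> where \<rho>: "strict_mono (\<rho> :: nat \<Rightarrow> nat)" and v: "?sol 0 v"
    and vlim: "uniform_limit UNIV (\<lambda>k. U (X0 (\<rho> k))) v sequentially"
    using cluster[OF X0 X0lim] by blast
  have lim0: "filterlim (\<lambda>k. Y (\<sigma> k)) (at_right 0) sequentially"
    if "\<And>k. Y k \<in> {0<..<1}" "Y \<longlonglongrightarrow> 0" "strict_mono (\<sigma> :: nat \<Rightarrow> nat)" for Y :: "nat \<Rightarrow> real" and \<sigma>
  proof -
    have "0 < Y (\<sigma> k)" "Y (\<sigma> k) \<noteq> 0" for k using that(1)[of "\<sigma> k"] by auto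
    then show ?thesis
      using LIMSEQ_subseq_LIMSEQ[OF that(2,3)] by (simp add: filterlim_at o_def)
  qed
  have "uniform_limit UNIV U v (at_right 0)"
  proof (rule ccontr)
    assume "\<not> uniform_limit UNIV U v (at_right 0)"
    then obtain e where e: "e > 0" and "\<not> (\<forall>\<^sub>F l in at_right 0. \<forall>x\<in>UNIV. dist (U l x) (v x) < e)"
      unfolding uniform_limit_iff by blast
    then have "\<exists>l. 0 < l \<and> l < b \<and> \<not> (\<forall>x. dist (U l x) (v x) < e)" if "b > 0" for b
      using that unfolding eventually_at_right[OF zero_less_one] by auto
    then have "\<forall>k. \<exists>l. 0 < l \<and> l < X0 k \<and> \<not> (\<forall>x. dist (U l x) (v x) < e)" using X0 by auto
    then obtain Y where Y: "\<And>k. 0 < Y k" "\<And>k. Y k < X0 k" "\<And>k. \<not> (\<forall>x. dist (U (Y k) x) (v x) < e)"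
      by metis
    have Y1: "Y k \<in> {0<..<1}" for k using Y(1,2)[of k] X0[of k] by auto
    have Ylim: "Y \<longlonglongrightarrow> 0"
      by (rule tendsto_sandwich[OF _ _ tendsto_const X0lim])
        (use Y(1,2) in \<open>auto intro!: always_eventually less_imp_le\<close>)
    obtain w \<sigma> where \<sigma>: "strict_mono (\<sigma> :: nat \<Rightarrow> nat)" and w: "?sol 0 w"
      and wlim: "uniform_limit UNIV (\<lambda>k. U (Y (\<sigma> k))) w sequentially"
      using cluster[OF Y1 Ylim] by blast
    \<comment> \<open>Limit points are compared through \<open>lower\<close>: \<open>w\<close>
      bounds \<open>U\<close> from below along \<open>X0\<close>, whose limit is \<open>v\<close>.
      Conversely \<open>v\<close> bounds \<open>U\<close> from below along \<open>Y\<close>, and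
      with |U - w| < e / 2 this traps \<open>U\<close> within \<open>e\<close> of \<open>v\<close>,
      against the choice of \<open>Y\<close>.\<close>
    have wv: "w x - e / 2 \<le> v x" for x
    proof (rule tendsto_lowerbound)
      show "(\<lambda>k. U (X0 (\<rho> k)) x) \<longlonglongrightarrow> v x" using tendsto_uniform_limitI[OF vlim] by simp
      have "\<forall>\<^sub>F l in at_right 0. \<forall>x. w x - e / 2 \<le> U l x"
        by (rule lower[OF Y1 w wlim]) (use e in simp)
      from eventually_compose_filterlim[OF this lim0[OF X0 X0lim \<rho>]]
      show "\<forall>\<^sub>F k in sequentially. w x - e / 2 \<le> U (X0 (\<rho> k)) x"
        by eventually_elim simp
    qed simp
    have "\<forall>\<^sub>F l in at_right 0. \<forall>x. v x - e / 2 \<le> U l x"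
      by (rule lower[OF X0 v vlim]) (use e in simp)
    then have "\<forall>\<^sub>F k in sequentially. \<forall>x. v x - e / 2 \<le> U (Y (\<sigma> k)) x"
      by (rule eventually_compose_filterlim[OF _ lim0[OF Y1 Ylim \<sigma>]])
    moreover have "\<forall>\<^sub>F k in sequentially. \<forall>x\<in>UNIV. dist (U (Y (\<sigma> k)) x) (w x) < e / 2"
      using uniform_limitD[OF wlim half_gt_zero[OF e]] .
    ultimately have "\<forall>\<^sub>F k in sequentially. \<forall>x. dist (U (Y (\<sigma> k)) x) (v x) < e"
    proof eventually_elim
      case (elim k)
      show ?case
      proof
        fix x
        have "v x - e / 2 \<le> U (Y (\<sigma> k)) x" "\<bar>U (Y (\<sigma> k)) x - w x\<bar> < e / 2"
          using elim by (auto simp: dist_real_def)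
        then show "dist (U (Y (\<sigma> k)) x) (v x) < e"
          using wv[of x] e unfolding dist_real_def by linarith
      qed
    qed
    then obtain k where "\<forall>x. dist (U (Y (\<sigma> k)) x) (v x) < e"
      using eventually_happens'[OF sequentially_bot] by blast
    then show False using Y(3) by blast
  qed
  then show ?thesis using unique v unfolding U_def by blast
qed

end

theorem theorem1:
  fixes \<nu> :: "(real ^ 'n::finite) measure"
    and j :: "real ^ 'n \<Rightarrow> real ^ 'n \<Rightarrow> real ^ 'n"
    and H :: "real ^ 'n \<Rightarrow> real ^ 'n \<Rightarrow> real"
    and c \<kappa> :: real
  assumes nu_borel: "sets \<nu> = sets borel"
    and j_periodic: "\<And>z. periodic (\<lambda>x. j x z)"
    and j_borel: "(\<lambda>(x, z). j x z) \<in> borel_measurable borel"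
    and N: "\<exists>C>0. (\<integral>\<^sup>+z. ennreal (min 1 ((norm z)\<^sup>2)) \<partial>\<nu>) \<le> ennreal C"
    and J1: "\<exists>C>0. \<forall>x y z. norm (j x z) \<le> C * norm z \<and>
                           norm (j x z - j y z) \<le> C * norm (x - y) * norm z"
    and J2: "\<forall>R>0. \<exists>C>0. \<forall>x y.
               (\<integral>\<^sup>+z\<in>UNIV - ball 0 R. ennreal (norm (j x z - j y z)) \<partial>\<nu>) \<le> ennreal (C * norm (x - y))"
    and H_periodic: "\<And>p. periodic (\<lambda>x. H x p)"
    and H_continuous: "continuous_on UNIV (\<lambda>(x, p). H x p)"
    and H_convex: "\<And>x. convex_on UNIV (H x)"
    and ex_solutions: "\<And>l. l \<in> {0..<1} \<Longrightarrow> \<exists>u. viscosity_solution \<nu> j H c l u"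
    and kappa_pos: "\<kappa> > 0"
    and lipschitz_solutions:
      "\<And>l u. l \<in> {0..<1} \<Longrightarrow> viscosity_solution \<nu> j H c l u \<Longrightarrow> \<kappa>-lipschitz_on UNIV u"
  shows "(\<forall>l\<in>{0<..<1}. \<exists>!u. viscosity_solution \<nu> j H c l u) \<and>
         (\<exists>u0. viscosity_solution \<nu> j H c 0 u0 \<and>
            uniform_limit UNIV (\<lambda>l. THE u. viscosity_solution \<nu> j H c l u) u0 (at_right 0))"
proof -
  obtain Cj where Cj: "Cj > 0" "\<And>x z. norm (j x z) \<le> Cj * norm z"
      "\<And>x y z. norm (j x z - j y z) \<le> Cj * norm (x - y) * norm z"
    using J1 by blast
  obtain Ct where Ct: "Ct > 0"
      "\<And>x y. (\<integral>\<^sup>+z\<in>UNIV - ball 0 1. ennreal (norm (j x z - j y z)) \<partial>\<nu>) \<le> ennreal (Ct * norm (x - y))"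
    using J2[rule_format, OF zero_less_one] by blast
  interpret levy_jumps \<nu> j Cj Ct
  proof
    show "j x \<in> borel_measurable borel" for x
    proof -
      have "Pair x \<in> borel_measurable borel"
        by (intro borel_measurable_continuous_onI continuous_intros)
      from measurable_compose[OF this j_borel] show ?thesis by simp
    qed
    show "(\<integral>\<^sup>+z. ennreal (levy_weight z) \<partial>\<nu>) < \<infinity>"
      using N unfolding levy_weight_def by (auto intro: le_less_trans)
  qed (fact nu_borel Cj Ct)+
  show ?thesis
    by (rule vanishing_discount[OF H_continuous H_convex ex_solutions lipschitz_solutions])
qed

end
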